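(* Let $(X_t)_{t\ge0}$ be a regular non-explosive birth–death process on $\mathbb{N}$ with birth rates $(\lambda_x)_{x\in\mathbb{N}}$, death rates $(\nu_x)_{x\in\mathbb{N}}$, and stationary distribution $\pi\in\mathscr{P}_1(\mathbb{N})$. Assume that $x\mapsto\lambda_x$ is non-increasing and $x\mapsto\nu_x$ is non-decreasing. If $f\in\mathrm{Lip}_d(\mathbb{N})$ and, further, $\|\Gamma f\|_\infty<+\infty$, then for any $x\in\mathbb{N}$, any $t>0$ and any $y>0$, $$\mathbb{P}_x\big(f(X_t)-\mathbb{E}_x[f(X_t)]\ge y\big)\le\exp\left(-\frac{y}{2\|f\|_{\mathrm{Lip}_d}}\log\left(1+\frac{y\|f\|_{\mathrm{Lip}_d}}{2t\|\Gamma f\|_\infty}\right)\right).$$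
   Context: Here $\mathbb{N}=\{0,1,2,\dots\}$ with metric $d(x,y)=|x-y|$. The birth–death process has generator $\mathcal{L}f(x)=\lambda_x(f(x+1)-f(x))+\nu_x(f(x-1)-f(x))$, where the rates are positive except $\nu_0=0$. Regular means that the rates determine the process uniquely. $\mathbb{P}_x,\mathbb{E}_x$ refer to the process started at $x$. $\mathrm{Lip}_d(\mathbb{N})$ is the space of $f:\mathbb{N}\to\mathbb{R}$ with $\|f\|_{\mathrm{Lip}_d}:=\sup_{x\ne y}|f(x)-f(y)|/|x-y|<+\infty$, $\|\cdot\|_\infty$ is the supremum norm, and $\Gamma f(x)=\frac12\{\lambda_x(f(x+1)-f(x))^2+\nu_x(f(x-1)-f(x))^2\}$. $\mathscr{P}_1(\mathbb{N})$ is the set of probability measures on $\mathbb{N}$ with finite first moment. *)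

theory Defs
  imports "HOL-Probability.Probability"
begin

definition birth_death_rates :: "(nat \<Rightarrow> real) \<Rightarrow> (nat \<Rightarrow> real) \<Rightarrow> bool" where
  "birth_death_rates lam \<nu> \<longleftrightarrow> (\<forall>x. 0 < lam x) \<and> \<nu> 0 = 0 \<and> (\<forall>x>0. 0 < \<nu> x)"

text \<open>At \<open>x = 0\<close> the truncated term \<open>x - 1\<close> is harmless, because \<open>\<nu> 0 = 0\<close>.\<close>

definition bd_generator ::
  "(nat \<Rightarrow> real) \<Rightarrow> (nat \<Rightarrow> real) \<Rightarrow> (nat \<Rightarrow> real) \<Rightarrow> nat \<Rightarrow> real" where
  "bd_generator lam \<nu> f x = lam x * (f (x + 1) - f x) + \<nu> x * (f (x - 1) - f x)"

definition carre_du_champ ::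
  "(nat \<Rightarrow> real) \<Rightarrow> (nat \<Rightarrow> real) \<Rightarrow> (nat \<Rightarrow> real) \<Rightarrow> nat \<Rightarrow> real" where
  "carre_du_champ lam \<nu> f x =
     1 / 2 * (lam x * (f (x + 1) - f x)\<^sup>2 + \<nu> x * (f (x - 1) - f x)\<^sup>2)"

text \<open>The suprema are taken in the reals, so each norm is meaningful only together with the
  matching boundedness predicate.\<close>

definition Lip :: "(nat \<Rightarrow> real) set" where
  "Lip = {f. bdd_above ((\<lambda>(x, y). \<bar>f x - f y\<bar> / \<bar>real x - real y\<bar>) ` {(x, y). x \<noteq> y})}"

definition Lip_norm :: "(nat \<Rightarrow> real) \<Rightarrow> real" where
  "Lip_norm f = (SUP (x, y)\<in>{(x, y). x \<noteq> y}. \<bar>f x - f y\<bar> / \<bar>real x - real y\<bar>)"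

definition finite_sup_norm :: "(nat \<Rightarrow> real) \<Rightarrow> bool" where
  "finite_sup_norm g \<longleftrightarrow> bdd_above (range (\<lambda>x. \<bar>g x\<bar>))"

definition sup_norm :: "(nat \<Rightarrow> real) \<Rightarrow> real" where
  "sup_norm g = (SUP x. \<bar>g x\<bar>)"

text \<open>Transition functions may be sub-stochastic, so that regularity below also excludes
  competing processes that lose mass by explosion. Times are reals; values at negative times are
  irrelevant.\<close>

definition transition_function :: "(real \<Rightarrow> nat \<Rightarrow> nat \<Rightarrow> real) \<Rightarrow> bool" where
  "transition_function p \<longleftrightarrow>
     (\<forall>t\<ge>0. \<forall>x y. 0 \<le> p t x y) \<and>
     (\<forall>t\<ge>0. \<forall>x. summable (p t x) \<and> suminf (p t x) \<le> 1) \<and>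
     (\<forall>x y. p 0 x y = (if x = y then 1 else 0)) \<and>
     (\<forall>s\<ge>0. \<forall>t\<ge>0. \<forall>x y. (\<lambda>z. p s x z * p t z y) sums p (s + t) x y)"

text \<open>The generator applied to the indicator of \<open>{y}\<close> is the \<open>(x, y)\<close> entry of the Q-matrix:
  \<open>lam x\<close> for \<open>y = x + 1\<close>, \<open>\<nu> x\<close> for \<open>y = x - 1\<close>, and \<open>- (lam x + \<nu> x)\<close> for \<open>y = x\<close>. In particular
  the right derivative at 0 entails that the transition function is standard.\<close>

definition has_bd_rates ::
  "(nat \<Rightarrow> real) \<Rightarrow> (nat \<Rightarrow> real) \<Rightarrow> (real \<Rightarrow> nat \<Rightarrow> nat \<Rightarrow> real) \<Rightarrow> bool" where
  "has_bd_rates lam \<nu> p \<longleftrightarrow>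
     (\<forall>x y. ((\<lambda>t. p t x y) has_real_derivative bd_generator lam \<nu> (indicator {y}) x) (at_right 0))"

definition regular_rates :: "(nat \<Rightarrow> real) \<Rightarrow> (nat \<Rightarrow> real) \<Rightarrow> bool" where
  "regular_rates lam \<nu> \<longleftrightarrow>
     (\<forall>p q. transition_function p \<and> has_bd_rates lam \<nu> p \<and>
            transition_function q \<and> has_bd_rates lam \<nu> q \<longrightarrow>
            (\<forall>t\<ge>0. \<forall>x y. p t x y = q t x y))"

text \<open>\<open>P x\<close> is the law under which the process starts at \<open>x\<close>; all the laws live on one
  measurable space. Since \<^typ>\<open>nat\<close> is discrete,
  right-continuity means that the path stays in each state it occupies
  for a positive time.\<close>

definition natural_filtration ::
  "'w set \<Rightarrow> (real \<Rightarrow> 'w \<Rightarrow> nat) \<Rightarrow> real \<Rightarrow> 'w set set" where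
  "natural_filtration \<Omega> X s = sigma_sets \<Omega> {X u -` B \<inter> \<Omega> |u B. 0 \<le> u \<and> u \<le> s}"

definition transition_prob ::
  "(nat \<Rightarrow> 'w measure) \<Rightarrow> (real \<Rightarrow> 'w \<Rightarrow> nat) \<Rightarrow> real \<Rightarrow> nat \<Rightarrow> nat \<Rightarrow> real" where
  "transition_prob P X t x y = \<P>(\<omega> in P x. X t \<omega> = y)"

definition markov_family ::
  "(nat \<Rightarrow> 'w measure) \<Rightarrow> (real \<Rightarrow> 'w \<Rightarrow> nat) \<Rightarrow> bool" where
  "markov_family P X \<longleftrightarrow>
     (\<forall>x. prob_space (P x)) \<and>
     (\<forall>x. sets (P x) = sets (P 0)) \<and>
     (\<forall>x. \<forall>t\<ge>0. X t \<in> P x \<rightarrow>\<^sub>M count_space UNIV) \<and>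
     (\<forall>x. AE \<omega> in P x. X 0 \<omega> = x) \<and>
     (\<forall>x. AE \<omega> in P x. \<forall>t\<ge>0. continuous (at_right t) (\<lambda>s. X s \<omega>)) \<and>
     (\<forall>x z y. \<forall>s\<ge>0. \<forall>t\<ge>0. \<forall>A \<in> natural_filtration (space (P x)) X s.
        \<P>(\<omega> in P x. \<omega> \<in> A \<and> X s \<omega> = z \<and> X (s + t) \<omega> = y) =
        \<P>(\<omega> in P x. \<omega> \<in> A \<and> X s \<omega> = z) * transition_prob P X t z y)"

definition birth_death_process ::
  "(nat \<Rightarrow> real) \<Rightarrow> (nat \<Rightarrow> real) \<Rightarrow> (nat \<Rightarrow> 'w measure) \<Rightarrow> (real \<Rightarrow> 'w \<Rightarrow> nat) \<Rightarrow> bool" where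
  "birth_death_process lam \<nu> P X \<longleftrightarrow>
     birth_death_rates lam \<nu> \<and> markov_family P X \<and> has_bd_rates lam \<nu> (transition_prob P X)"

text \<open>The jump times of a right-continuous path in a discrete space are its discontinuities.\<close>

definition non_explosive ::
  "(nat \<Rightarrow> 'w measure) \<Rightarrow> (real \<Rightarrow> 'w \<Rightarrow> nat) \<Rightarrow> bool" where
  "non_explosive P X \<longleftrightarrow>
     (\<forall>x. AE \<omega> in P x. \<forall>t\<ge>0. finite {s \<in> {0<..t}. \<not> isCont (\<lambda>r. X r \<omega>) s})"

definition stationary_distribution ::
  "(nat \<Rightarrow> 'w measure) \<Rightarrow> (real \<Rightarrow> 'w \<Rightarrow> nat) \<Rightarrow> nat pmf \<Rightarrow> bool" where
  "stationary_distribution P X \<pi> \<longleftrightarrow>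
     (\<forall>t\<ge>0. \<forall>y. measure_pmf.expectation \<pi> (\<lambda>x. transition_prob P X t x y) = pmf \<pi> y)"

definition finite_first_moment :: "nat pmf \<Rightarrow> bool" where
  "finite_first_moment \<pi> \<longleftrightarrow> integrable (measure_pmf \<pi>) real"

end

theory Submission
  imports Defs
begin

text \<open>
  Write \<open>u\<^sub>t(x) = E\<^sub>x f(X\<^sub>t)\<close>. Everything is read off the backward equation \<open>\<partial>\<^sub>t u = L u\<close> by maximum
  principles; paths and the forward equation play no role. Monotone rates make \<open>\<partial>\<^sub>t - L\<close> commute with
  increments up to a killing term and give \<open>\<Gamma>\<^sub>2 \<ge> 0\<close>, so neither the Lipschitz constant nor the bound
  on \<open>\<Gamma>\<close> increases along the flow. Hence, with \<open>c = 2 V (e^(\<theta>L) - 1 - \<theta>L) / L^2\<close>,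
  \<open>exp (\<theta> u\<^sub>t + c t)\<close> is a supersolution of the backward equation that starts at \<open>e^(\<theta> f)\<close>, and it
  dominates the solution \<open>E\<^sub>x e^(\<theta> f(X\<^sub>t))\<close>. The Chernoff bound and \<open>(1 + s/2) ln (1 + s) \<ge> s\<close>
  finish the proof.

  The death rates may be unbounded, so the propagation of the bound on \<open>\<Gamma>\<close> is carried out for the rates
  \<open>\<nu> (min x N)\<close>, whose backward equation is solved by the power series \<open>\<Sum>t^n L^n f / n!\<close>. Its
  solutions converge to \<open>u\<close> as \<open>N \<rightarrow> \<infinity>\<close>, because the birth rates are bounded and the barrier
  \<open>(x + \<lambda>\<^sub>0 t) / N\<close> controls what comes in from the state \<open>N\<close>.
\<close>

section \<open>Maximum principles for the backward equation\<close>

text \<open>Continuity is a separate clause because a right derivative at \<open>t\<close> says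
  nothing about left limits. Together the two carry a bound up to a first critical time and then
  past it.\<close>

definition backward_solution ::
  "(nat \<Rightarrow> real) \<Rightarrow> (nat \<Rightarrow> real) \<Rightarrow> (real \<Rightarrow> nat \<Rightarrow> real) \<Rightarrow> bool" where
  "backward_solution a b u \<longleftrightarrow>
     (\<forall>x. continuous_on {0..} (\<lambda>t. u t x)) \<and>
     (\<forall>t\<ge>0. \<forall>x. ((\<lambda>s. u s x) has_real_derivative bd_generator a b (u t) x) (at_right t))"

text \<open>The function \<open>w\<close> may exceed 0 at the boundary state \<open>N\<close>, by at most \<open>C\<close>. Only right derivatives
  are assumed, since those are what the semigroup property yields directly.\<close>

lemma comparison:
  fixes w w' :: "real \<Rightarrow> nat \<Rightarrow> real"
  assumes a: "\<And>x. 0 \<le> a x" "\<And>x. a x \<le> A" and b: "\<And>x. 0 \<le> b x" "b 0 = 0"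
    and N: "0 < N" and C: "0 \<le> C"
    and cont: "\<And>x. x \<le> N \<Longrightarrow> continuous_on {0..T} (\<lambda>t. w t x)"
    and deriv: "\<And>t x. 0 \<le> t \<Longrightarrow> t < T \<Longrightarrow> x < N \<Longrightarrow>
      ((\<lambda>s. w s x) has_real_derivative w' t x) (at_right t)"
    and sub: "\<And>t x. 0 \<le> t \<Longrightarrow> t < T \<Longrightarrow> x < N \<Longrightarrow> 0 < w t x \<Longrightarrow>
      w' t x \<le> bd_generator a b (w t) x"
    and init: "\<And>x. x < N \<Longrightarrow> w 0 x \<le> 0"
    and bound: "\<And>t. 0 \<le> t \<Longrightarrow> t \<le> T \<Longrightarrow> w t N \<le> C"
    and t: "0 \<le> t" "t \<le> T" and x: "x \<le> N"
  shows "w t x \<le> C * (real x + A * t) / real N"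
proof -
  have A: "0 \<le> A" using a[of 0] by linarith
  \<comment> \<open>The barrier is at least \<open>C\<close> at the state \<open>N\<close> and
    nonnegative everywhere for \<open>t \<ge> 0\<close>. It grows by \<open>C / N\<close> per state
    and at rate \<open>C * A / N\<close> in time, so births at rate at most \<open>A\<close> cannot
    push \<open>w\<close> through it.\<close>
  define B where "B t x = C * (real x + A * t) / real N" for t x
  have B_nonneg: "0 \<le> B t x" if "0 \<le> t" for t x
    using that A C by (auto simp: B_def)
  have B_Suc: "B t (Suc x) = B t x + C / N" for t x
    by (simp add: B_def algebra_simps add_divide_distrib)
  have main: "w t x \<le> B t x + \<epsilon> * (1 + t)"
    if \<epsilon>: "0 < \<epsilon>" and tx: "0 \<le> t" "t \<le> T" "x \<le> N" for \<epsilon> t x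
  proof (rule ccontr)
    assume neg: "\<not> ?thesis"
    \<comment> \<open>The term \<open>\<epsilon> * (1 + s)\<close> makes \<open>z\<close> strictly
      negative at time 0 and supplies the strict decrease needed at a state where \<open>z\<close>
      vanishes.\<close>
    define z where "z s y = w s y - B s y - \<epsilon> * (1 + s)" for s y
    define S where "S = {s \<in> {0..T}. \<exists>y\<le>N. 0 < z s y}"
    \<comment> \<open>Up to and including \<open>\<tau>\<close> no \<open>z s y\<close> is positive;
      the contradiction comes from extending this to an interval to the right of
      \<open>\<tau>\<close>.\<close>
    define \<tau> where "\<tau> = Inf S"
    have tS: "t \<in> S" using neg tx by (auto simp: S_def z_def)
    have bdd: "bdd_below S" by (rule bdd_belowI[of _ 0]) (auto simp: S_def)
    have \<tau>: "0 \<le> \<tau>" "\<tau> \<le> T"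
    proof -
      show "0 \<le> \<tau>" unfolding \<tau>_def using tS by (intro cInf_greatest) (auto simp: S_def)
      show "\<tau> \<le> T" unfolding \<tau>_def using cInf_lower[OF tS bdd] tx by linarith
    qed
    have before: "z s y \<le> 0" if "0 \<le> s" "s < \<tau>" "y \<le> N" for s y
    proof (rule ccontr)
      assume "\<not> ?thesis"
      with that \<tau> have "s \<in> S" by (auto simp: S_def)
      from cInf_lower[OF this bdd] that show False by (simp add: \<tau>_def)
    qed
    have zcont: "continuous_on {0..T} (\<lambda>s. z s y)" if "y \<le> N" for y
      unfolding z_def B_def using N by (intro continuous_intros cont that) auto
    have at: "z \<tau> y \<le> 0" if y: "y \<le> N" for y
    proof (cases "\<tau> = 0")
      case True
      show ?thesis
      proof (cases "y = N")
        case True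
        then have "w \<tau> y \<le> C" using bound \<tau> by auto
        moreover have "B \<tau> y = C" using True N \<open>\<tau> = 0\<close> by (simp add: B_def)
        ultimately show ?thesis using \<epsilon> \<open>\<tau> = 0\<close> by (simp add: z_def)
      next
        case False
        then have "w 0 y \<le> 0" using init y by simp
        then show ?thesis using B_nonneg[of 0 y] \<epsilon> True by (simp add: z_def)
      qed
    next
      case False
      then have pos: "0 < \<tau>" using \<tau> by simp
      have "((\<lambda>s. z s y) \<longlongrightarrow> z \<tau> y) (at \<tau> within {0..T})"
        using zcont[OF y] \<tau> by (simp add: continuous_on)
      then have "((\<lambda>s. z s y) \<longlongrightarrow> z \<tau> y) (at \<tau> within {0..<\<tau>})"
        by (rule tendsto_within_subset) (use \<tau> in auto)
      moreover have "at \<tau> within {0..<\<tau>} \<noteq> bot"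
        using pos by (simp add: trivial_limit_within islimpt_Ico)
      moreover have "eventually (\<lambda>s. z s y \<le> 0) (at \<tau> within {0..<\<tau>})"
        unfolding eventually_at using before y by (intro exI[of _ 1]) auto
      ultimately show ?thesis using tendsto_upperbound by blast
    qed
    have "\<tau> < T"
    proof (rule ccontr)
      assume "\<not> ?thesis"
      then have "\<tau> = T" using \<tau> by simp
      obtain s y where s: "s \<in> {0..T}" "y \<le> N" "0 < z s y" using tS by (auto simp: S_def)
      then show False using before[of s y] at[of y] \<open>\<tau> = T\<close> by (cases "s = T") auto
    qed
    have after: "eventually (\<lambda>s. z s y \<le> 0) (at_right \<tau>)" if y: "y \<le> N" for y
    proof (cases "z \<tau> y < 0")
      case True
      have "((\<lambda>s. z s y) \<longlongrightarrow> z \<tau> y) (at \<tau> within {0..T})"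
        using zcont[OF y] \<tau> by (simp add: continuous_on)
      then have "((\<lambda>s. z s y) \<longlongrightarrow> z \<tau> y) (at \<tau> within {\<tau><..<T})"
        by (rule tendsto_within_subset) (use \<tau> in auto)
      moreover have "at \<tau> within {\<tau><..<T} = at_right \<tau>"
        using \<open>\<tau> < T\<close> by (intro at_within_nhd[of _ "{..<T}"]) auto
      ultimately have "eventually (\<lambda>s. z s y < 0) (at_right \<tau>)"
        using True order_tendstoD(2) by metis
      then show ?thesis by eventually_elim simp
    next
      case False
      then have z0: "z \<tau> y = 0" using at[OF y] by simp
      have "y \<noteq> N"
      proof
        assume "y = N"
        then have "w \<tau> y \<le> C" using bound \<tau> by simp
        moreover have "C \<le> B \<tau> y" using \<open>y = N\<close> N C A \<tau>
          by (simp add: B_def field_simps)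
        ultimately show False using z0 \<epsilon> \<tau> by (simp add: z_def) (smt (verit) mult_pos_pos)
      qed
      then have yN: "y < N" using y by simp
      \<comment> \<open>Here \<open>w\<close> touches the shifted barrier at \<open>y\<close> and
        lies below it at the neighbours, so its increments towards them are at most those of
        \<open>B\<close>.\<close>
      have w: "w \<tau> y = B \<tau> y + \<epsilon> * (1 + \<tau>)" using z0 by (simp add: z_def)
      then have "0 < w \<tau> y" using B_nonneg[of \<tau> y] \<epsilon> \<tau> by (smt (verit) mult_pos_pos)
      from sub[OF \<tau>(1) \<open>\<tau> < T\<close> yN this]
      have "w' \<tau> y \<le> a y * (w \<tau> (y + 1) - w \<tau> y) + b y * (w \<tau> (y - 1) - w \<tau> y)"
        by (simp add: bd_generator_def)
      also have "w \<tau> (y + 1) - w \<tau> y \<le> C / N"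
        using at[of "Suc y"] yN w B_Suc[of \<tau> y] by (simp add: z_def)
      then have "a y * (w \<tau> (y + 1) - w \<tau> y) \<le> a y * (C / N)"
        using a by (intro mult_left_mono)
      also have "a y * (C / N) \<le> A * (C / N)"
        using a C by (intro mult_right_mono) auto
      also have "b y * (w \<tau> (y - 1) - w \<tau> y) \<le> 0"
      proof (cases y)
        case (Suc k)
        then have "w \<tau> (y - 1) - w \<tau> y \<le> - (C / N)"
          using at[of k] yN w B_Suc[of \<tau> k] by (simp add: z_def)
        also have "\<dots> \<le> 0" using C by simp
        finally show ?thesis using b(1)[of y] by (simp add: mult_nonneg_nonpos)
      qed (simp add: b)
      finally have w'_le: "w' \<tau> y \<le> A * (C / N)" by simp
      have "((\<lambda>s. z s y) has_real_derivative w' \<tau> y - C * A / N - \<epsilon>) (at_right \<tau>)"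
        unfolding z_def B_def using N
        by (auto intro!: derivative_eq_intros deriv[OF \<tau>(1) \<open>\<tau> < T\<close> yN])
      moreover have "w' \<tau> y - C * A / N - \<epsilon> < 0" using w'_le \<epsilon> by (simp add: mult.commute)
      ultimately obtain d where "0 < d" and
        d: "\<And>h. 0 < h \<Longrightarrow> \<tau> + h \<in> {\<tau><..} \<Longrightarrow> h < d \<Longrightarrow> z (\<tau> + h) y < z \<tau> y"
        using has_real_derivative_neg_dec_right by meson
      show ?thesis unfolding eventually_at_right_field
        using \<open>0 < d\<close> d[of "s - \<tau>" for s] z0
        by (intro exI[of _ "\<tau> + d"]) (force simp: less_imp_le)
    qed
    \<comment> \<open>Only the finitely many states up to \<open>N\<close> occur, so one right
      neighbourhood of \<open>\<tau>\<close> serves them all.\<close>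
    have "eventually (\<lambda>s. \<forall>y\<in>{..N}. z s y \<le> 0) (at_right \<tau>)"
      by (rule eventually_ball_finite) (auto intro: after)
    then obtain e where e: "\<tau> < e" "\<And>s y. \<tau> < s \<Longrightarrow> s < e \<Longrightarrow> y \<le> N \<Longrightarrow> z s y \<le> 0"
      unfolding eventually_at_right_field by auto
    have "e \<le> s" if s: "s \<in> S" for s
    proof (rule ccontr)
      assume "\<not> e \<le> s"
      moreover obtain y where "0 \<le> s" "y \<le> N" "0 < z s y" using s by (auto simp: S_def)
      ultimately show False
        using before[of s y] e(2)[of s y] at[of y] by (cases s \<tau> rule: linorder_cases) auto
    qed
    then have "e \<le> \<tau>" unfolding \<tau>_def using tS by (intro cInf_greatest) auto
    with e show False by simp
  qed
  show ?thesis
  proof (rule field_le_epsilon)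
    fix e :: real assume e: "0 < e"
    have "w t x \<le> B t x + e / (1 + t) * (1 + t)"
      using main[of "e / (1 + t)" t x] e t x by simp
    then show "w t x \<le> C * (real x + A * t) / real N + e"
      using t by (simp add: B_def)
  qed
qed

text \<open>When \<open>w\<close> is bounded above, every \<open>N\<close> can serve as the boundary
  state in \<open>comparison\<close>, and the barrier vanishes as \<open>N\<close> tends to
  infinity. The size of \<open>C\<close> does not enter the conclusion.\<close>

lemma maximum_principle:
  fixes w w' :: "real \<Rightarrow> nat \<Rightarrow> real"
  assumes a: "\<And>x. 0 \<le> a x" "\<And>x. a x \<le> A" and b: "\<And>x. 0 \<le> b x" "b 0 = 0"
    and cont: "\<And>x. continuous_on {0..T} (\<lambda>t. w t x)"
    and deriv: "\<And>t x. 0 \<le> t \<Longrightarrow> t < T \<Longrightarrow>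
      ((\<lambda>s. w s x) has_real_derivative w' t x) (at_right t)"
    and sub: "\<And>t x. 0 \<le> t \<Longrightarrow> t < T \<Longrightarrow> 0 < w t x \<Longrightarrow>
      w' t x \<le> bd_generator a b (w t) x"
    and init: "\<And>x. w 0 x \<le> 0"
    and bound: "\<And>t x. 0 \<le> t \<Longrightarrow> t \<le> T \<Longrightarrow> w t x \<le> C"
    and t: "0 \<le> t" "t \<le> T"
  shows "w t x \<le> 0"
proof (rule LIMSEQ_le_const)
  show "(\<lambda>N. max C 0 * (real x + A * t) / real N) \<longlonglongrightarrow> 0"
    by (rule lim_const_over_n)
  have "w t x \<le> max C 0 * (real x + A * t) / real N" if "Suc x \<le> N" for N
    by (rule comparison[where a = a and A = A and b = b and T = T and w = w and w' = w'])
       (use that a b cont deriv sub init bound t in \<open>auto simp: max.coboundedI1\<close>)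
  then show "\<exists>M. \<forall>N\<ge>M. w t x \<le> max C 0 * (real x + A * t) / real N" by blast
qed


lemma bd_generator_diff:
  "bd_generator a b (\<lambda>x. v x - w x) x = bd_generator a b v x - bd_generator a b w x"
  by (simp add: bd_generator_def algebra_simps)

lemma bd_generator_const [simp]: "bd_generator a b (\<lambda>_. c) x = 0"
  by (simp add: bd_generator_def)

lemma backward_solutionD:
  assumes "backward_solution a b u"
  shows "continuous_on {0..T} (\<lambda>t. u t x)"
    and "0 \<le> t \<Longrightarrow> ((\<lambda>s. u s x) has_real_derivative bd_generator a b (u t) x) (at_right t)"
  using assms unfolding backward_solution_def by (auto intro: continuous_on_subset)

lemma backward_solution_uminus:
  assumes "backward_solution a b u"
  shows "backward_solution a b (\<lambda>t x. - u t x)"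
  using assms unfolding backward_solution_def
  by (auto intro!: derivative_eq_intros continuous_intros simp: bd_generator_def algebra_simps)

section \<open>Solutions for bounded rates\<close>

text \<open>Each application of the generator multiplies the sup norm by at most
  \<open>2 * (A + B)\<close>. This makes the exponential series converge.\<close>

lemma bd_generator_power_le:
  assumes a: "\<And>x. 0 \<le> a x" "\<And>x. a x \<le> A" and b: "\<And>x. 0 \<le> b x" "\<And>x. b x \<le> B"
    and f: "\<And>x. \<bar>f x\<bar> \<le> C"
  shows "\<bar>(bd_generator a b ^^ n) f x\<bar> \<le> (2 * (A + B)) ^ n * C"
proof (induction n arbitrary: x)
  case (Suc n)
  let ?g = "(bd_generator a b ^^ n) f" and ?D = "(2 * (A + B)) ^ n * C"
  have *: "c * \<bar>?g y - ?g x\<bar> \<le> c' * (2 * ?D)" if "0 \<le> c" "c \<le> c'" for c c' y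
    using that Suc.IH[of y] Suc.IH[of x] by (intro mult_mono) auto
  have "\<bar>bd_generator a b ?g x\<bar> \<le> a x * \<bar>?g (x + 1) - ?g x\<bar> + b x * \<bar>?g (x - 1) - ?g x\<bar>"
    unfolding bd_generator_def using a b by (intro order_trans[OF abs_triangle_ineq]) (simp add: abs_mult)
  also have "\<dots> \<le> A * (2 * ?D) + B * (2 * ?D)"
    using a b by (intro add_mono *)
  finally show ?case by (simp add: algebra_simps)
qed (use f in auto)

text \<open>Bounded rates make the generator a bounded operator, and its exponential applied to
  \<open>f\<close> can be summed state by state as a real power series in \<open>t\<close>.\<close>

lemma backward_solution_exists:
  assumes a: "\<And>x. 0 \<le> a x" "\<And>x. a x \<le> A" and b: "\<And>x. 0 \<le> b x" "\<And>x. b x \<le> B"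
    and f: "\<And>x. \<bar>f x\<bar> \<le> C"
  shows "\<exists>u. u 0 = f \<and> backward_solution a b u \<and>
    (\<forall>t\<ge>0. \<forall>x. \<bar>u t x\<bar> \<le> C * exp (2 * (A + B) * t))"
proof -
  define R where "R = 2 * (A + B)"
  define c where "c x n = (bd_generator a b ^^ n) f x / fact n" for x n
  define u where "u t x = (\<Sum>n. c x n * t ^ n)" for t x
  have c_le: "\<bar>c x n * t ^ n\<bar> \<le> C * ((R * \<bar>t\<bar>) ^ n /\<^sub>R fact n)" for x n t
  proof -
    have "\<bar>c x n * t ^ n\<bar> = \<bar>(bd_generator a b ^^ n) f x\<bar> * \<bar>t\<bar> ^ n / fact n"
      by (simp add: c_def abs_mult power_abs)
    also have "\<dots> \<le> R ^ n * C * \<bar>t\<bar> ^ n / fact n"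
      unfolding R_def by (intro divide_right_mono mult_right_mono bd_generator_power_le a b f) auto
    finally show ?thesis by (simp add: power_mult_distrib field_simps)
  qed
  have sum_exp: "(\<lambda>n. C * ((R * \<bar>t\<bar>) ^ n /\<^sub>R fact n)) sums (C * exp (R * \<bar>t\<bar>))" for t :: real
    by (intro sums_mult exp_converges)
  have summ: "summable (\<lambda>n. c x n * t ^ n)" for x t
    by (rule summable_comparison_test'[OF sums_summable[OF sum_exp[of t]]]) (use c_le in auto)
  \<comment> \<open>Differentiating the series in \<open>t\<close> has the same effect on its
    coefficients as applying the generator; this is the backward equation.\<close>
  have c_Suc: "diffs (c x) n = bd_generator a b (\<lambda>y. c y n) x" for x n
  proof -
    have "diffs (c x) n = bd_generator a b ((bd_generator a b ^^ n) f) x / fact n"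
      by (simp add: diffs_def c_def del: of_nat_Suc)
    then show ?thesis by (simp add: bd_generator_def c_def diff_divide_distrib add_divide_distrib
          right_diff_distrib)
  qed
  have deriv: "((\<lambda>s. u s x) has_real_derivative bd_generator a b (u t) x) (at t)" for t x
  proof -
    have "(\<lambda>n. bd_generator a b (\<lambda>y. c y n * t ^ n) x) sums bd_generator a b (u t) x"
      unfolding bd_generator_def u_def
      by (intro sums_add sums_mult sums_diff summable_sums summ)
    moreover have "bd_generator a b (\<lambda>y. c y n * t ^ n) x = diffs (c x) n * t ^ n" for n
      unfolding c_Suc by (simp add: bd_generator_def algebra_simps)
    ultimately have "(\<Sum>n. diffs (c x) n * t ^ n) = bd_generator a b (u t) x"
      by (simp add: sums_iff)
    then show ?thesis
      using termdiffs_strong_converges_everywhere[of "c x" t] summ by (simp add: u_def)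
  qed
  have "u 0 = f" by (rule ext) (simp only: u_def powser_zero, simp add: c_def)
  moreover have "continuous_on {0..} (\<lambda>t. u t x)" for x
    by (rule DERIV_continuous_on[OF has_field_derivative_at_within[OF deriv]])
  then have "backward_solution a b u"
    unfolding backward_solution_def using has_field_derivative_at_within[OF deriv] by simp
  moreover have "\<bar>u t x\<bar> \<le> C * exp (R * t)" if "0 \<le> t" for t x
  proof -
    have "summable (\<lambda>n. \<bar>c x n * t ^ n\<bar>)"
      by (rule summable_comparison_test'[OF sums_summable[OF sum_exp[of t]]]) (use c_le in auto)
    then have "\<bar>u t x\<bar> \<le> (\<Sum>n. C * ((R * \<bar>t\<bar>) ^ n /\<^sub>R fact n))"
      unfolding u_def using c_le sum_exp[of t]
      by (intro order_trans[OF summable_rabs] suminf_le) (auto simp: sums_iff)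
    then show ?thesis using sum_exp[of t] that by (simp add: sums_iff)
  qed
  ultimately show ?thesis unfolding R_def by blast
qed

section \<open>Gradient bounds for monotone rates\<close>

text \<open>Constants solve the equation, so the maximum principle applies to \<open>u - K\<close>.
  A crude bound \<open>C\<close> on the interval is thereby replaced by the bound on the initial
  values.\<close>

lemma backward_solution_le:
  assumes a: "\<And>x. 0 \<le> a x" "\<And>x. a x \<le> A" and b: "\<And>x. 0 \<le> b x" "b 0 = 0"
    and u: "backward_solution a b u"
    and init: "\<And>x. u 0 x \<le> K"
    and bound: "\<And>s x. 0 \<le> s \<Longrightarrow> s \<le> t \<Longrightarrow> u s x \<le> C"
    and t: "0 \<le> t"
  shows "u t x \<le> K"
proof -
  have "u t x - K \<le> 0"
    by (rule maximum_principle[where a = a and A = A and b = b and T = t and C = "C - K"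
          and w = "\<lambda>t x. u t x - K" and w' = "\<lambda>t x. bd_generator a b (u t) x"])
      (use a b init bound t in \<open>auto simp: bd_generator_diff
        intro!: continuous_intros backward_solutionD[OF u] derivative_eq_intros\<close>)
  then show ?thesis by simp
qed

text \<open>The increment solves a backward equation with birth rates \<open>a (x + 1)\<close>,
  death rates \<open>b x\<close> and killing rate \<open>a x - a (x + 1) + b (x + 1) - b x\<close>,
  which is nonnegative for monotone rates. Applied to \<open>- u\<close>, this also bounds the
  increment from below.\<close>

lemma backward_solution_increment_le:
  assumes a: "\<And>x. 0 \<le> a x" "antimono a" and b: "mono b" "b 0 = 0"
    and u: "backward_solution a b u"
    and init: "\<And>x. u 0 (x + 1) - u 0 x \<le> L"
    and bound: "\<And>s x. 0 \<le> s \<Longrightarrow> s \<le> t \<Longrightarrow> \<bar>u s x\<bar> \<le> C"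
    and t: "0 \<le> t" and L: "0 \<le> L"
  shows "u t (x + 1) - u t x \<le> L"
proof -
  have b_nonneg: "0 \<le> b x" for x using monoD[OF b(1), of 0 x] b(2) by simp
  let ?w = "\<lambda>t x. u t (x + 1) - u t x - L"
  have "?w t x \<le> 0"
  proof (rule maximum_principle[where a = "\<lambda>x. a (x + 1)" and A = "a 0" and b = b and T = t
        and w = ?w and C = "2 * C"
        and w' = "\<lambda>t x. bd_generator a b (u t) (x + 1) - bd_generator a b (u t) x"])
    fix s x assume s: "0 \<le> s" "s < t" "0 < ?w s x"
    \<comment> \<open>The difference is minus the killing term. Where \<open>?w\<close> is positive
      the increment exceeds \<open>L \<ge> 0\<close>, so that term has the right sign.\<close>
    have "bd_generator a b (u s) (x + 1) - bd_generator a b (u s) x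
        - bd_generator (\<lambda>x. a (x + 1)) b (?w s) x
        = (a (x + 1) - a x + (b x - b (x + 1))) * (u s (x + 1) - u s x)"
      using b(2) by (cases x) (simp_all add: bd_generator_def algebra_simps)
    also have "\<dots> \<le> 0"
      using s L antimonoD[OF a(2), of x "x + 1"] monoD[OF b(1), of x "x + 1"]
      by (intro mult_nonpos_nonneg) auto
    finally show "bd_generator a b (u s) (x + 1) - bd_generator a b (u s) x
      \<le> bd_generator (\<lambda>x. a (x + 1)) b (?w s) x" by simp
  next
    fix s x assume "0 \<le> s" "s \<le> t"
    then show "?w s x \<le> 2 * C" using bound[of s x] bound[of s "x + 1"] L by linarith
  qed (use a b b_nonneg antimonoD[OF a(2), of 0] init t in
      \<open>auto intro!: continuous_intros backward_solutionD[OF u] derivative_eq_intros\<close>)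
  then show ?thesis by simp
qed

text \<open>The inequality \<open>\<Gamma>\<^sub>2 \<ge> 0\<close>: the right-hand side minus the left-hand side is, up to the
  factor 2, a sum of squares with coefficients that monotonicity of the rates makes
  nonnegative.\<close>

lemma carre_du_champ_subsolution:
  assumes a: "\<And>x. 0 \<le> a x" "antimono a" and b: "mono b" "b 0 = 0"
  shows "a x * (v (x + 1) - v x) * (bd_generator a b v (x + 1) - bd_generator a b v x)
      + b x * (v (x - 1) - v x) * (bd_generator a b v (x - 1) - bd_generator a b v x)
    \<le> bd_generator a b (carre_du_champ a b v) x" (is "?l \<le> ?r")
proof -
  have b_nonneg: "0 \<le> b x" for x using monoD[OF b(1), of 0 x] b(2) by simp
  have am: "a (Suc y) \<le> a y" for y using antimonoD[OF a(2), of y "Suc y"] by simp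
  have bm: "b y \<le> b (Suc y)" for y using monoD[OF b(1), of y "Suc y"] by simp
  show ?thesis
  proof (cases x)
    case 0
    define p q where "p = v 2 - v 1" and "q = v 1 - v 0"
    have "2 * (?r - ?l) = a 0 * a 1 * (p - q)\<^sup>2
        + (3 * (a 0 * b 1) + a 0 * (a 0 - a 1)) * q\<^sup>2"
      unfolding 0 p_def q_def
      by (simp add: bd_generator_def carre_du_champ_def b numeral_2_eq_2 power2_eq_square algebra_simps)
    also have "\<dots> \<ge> 0" using a b_nonneg am[of 0] by (intro add_nonneg_nonneg mult_nonneg_nonneg) auto
    finally show ?thesis by simp
  next
    case (Suc k)
    \<comment> \<open>For \<open>k = 0\<close> the truncated \<open>k - 1\<close> distorts
      \<open>s\<close>, but the only term containing \<open>s\<close> has the factor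
      \<open>b k = 0\<close>.\<close>
    define p q r s where "p = v (Suc (Suc (Suc k))) - v (Suc (Suc k))"
      and "q = v (Suc (Suc k)) - v (Suc k)" and "r = v (Suc k) - v k" and "s = v k - v (k - 1)"
    have "2 * (?r - ?l) = a (k+1) * a (k+2) * (p - q)\<^sup>2 + b (k+1) * b k * (s - r)\<^sup>2
        + 2 * a (k+1) * b (k+1) * (q - r)\<^sup>2
        + (3 * (a (k+1) * (b (k+2) - b (k+1))) + a (k+1) * (a (k+1) - a (k+2))) * q\<^sup>2
        + (3 * (b (k+1) * (a k - a (k+1))) + b (k+1) * (b (k+1) - b k)) * r\<^sup>2"
      unfolding Suc p_def q_def r_def s_def
      by (simp add: bd_generator_def carre_du_champ_def power2_eq_square algebra_simps)
    also have "\<dots> \<ge> 0"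
      using a b_nonneg am[of k] am[of "Suc k"] bm[of k] bm[of "Suc k"]
      by (intro add_nonneg_nonneg mult_nonneg_nonneg) auto
    finally show ?thesis by simp
  qed
qed

text \<open>By the preceding inequality \<open>carre_du_champ a b (u t) - V\<close> is a
  subsolution. The bound \<open>B\<close> on the death rates makes it bounded a priori, as the
  maximum principle requires.\<close>

lemma backward_solution_carre_du_champ_le:
  assumes a: "\<And>x. 0 \<le> a x" "antimono a" and b: "mono b" "b 0 = 0" "\<And>x. b x \<le> B"
    and u: "backward_solution a b u"
    and init: "\<And>x. carre_du_champ a b (u 0) x \<le> V"
    and bound: "\<And>s x. 0 \<le> s \<Longrightarrow> s \<le> t \<Longrightarrow> \<bar>u s x\<bar> \<le> C"
    and t: "0 \<le> t"
  shows "carre_du_champ a b (u t) x \<le> V"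
proof -
  have b_nonneg: "0 \<le> b x" for x using monoD[OF b(1), of 0 x] b(2) by simp
  have a_le: "a x \<le> a 0" for x using antimonoD[OF a(2), of 0 x] by simp
  \<comment> \<open>The time derivative of the carre du champ: twice its polarised form at
    \<open>u s\<close> and \<open>bd_generator a b (u s)\<close>.\<close>
  let ?w' = "\<lambda>s x. a x * (u s (x + 1) - u s x) * (bd_generator a b (u s) (x + 1) - bd_generator a b (u s) x)
    + b x * (u s (x - 1) - u s x) * (bd_generator a b (u s) (x - 1) - bd_generator a b (u s) x)"
  let ?w = "\<lambda>s x. carre_du_champ a b (u s) x - V"
  have "?w t x \<le> 0"
  proof (rule maximum_principle[where a = a and A = "a 0" and b = b and T = t
        and C = "1 / 2 * (a 0 * (2 * C)\<^sup>2 + B * (2 * C)\<^sup>2) - V" and w = ?w and w' = ?w'])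
    fix s x assume s: "0 \<le> s" "s \<le> t"
    have sq: "(u s y - u s x)\<^sup>2 \<le> (2 * C)\<^sup>2" for y
      using bound[OF s, of x] bound[OF s, of y] by (intro abs_le_square_iff[THEN iffD1]) auto
    have "a x * (u s (x + 1) - u s x)\<^sup>2 \<le> a 0 * (2 * C)\<^sup>2"
      using sq a a_le by (intro mult_mono) auto
    moreover have "b x * (u s (x - 1) - u s x)\<^sup>2 \<le> B * (2 * C)\<^sup>2"
      using sq b_nonneg b(3) order_trans[OF b_nonneg b(3)] by (intro mult_mono) auto
    ultimately show "?w s x \<le> 1 / 2 * (a 0 * (2 * C)\<^sup>2 + B * (2 * C)\<^sup>2) - V"
      unfolding carre_du_champ_def by (intro diff_right_mono mult_left_mono add_mono) auto
  next
    fix s x assume s: "0 \<le> s" "s < t"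
    show "((\<lambda>r. ?w r x) has_real_derivative ?w' s x) (at_right s)"
      unfolding carre_du_champ_def
      by (auto intro!: derivative_eq_intros backward_solutionD(2)[OF u s(1)])
    show "?w' s x \<le> bd_generator a b (?w s) x"
      using carre_du_champ_subsolution[OF a b(1,2)] by (simp add: bd_generator_diff)
  next
    fix x show "continuous_on {0..t} (\<lambda>t. ?w t x)"
      unfolding carre_du_champ_def by (intro continuous_intros backward_solutionD[OF u])
  qed (use a a_le b_nonneg b(2) init t in auto)
  then show ?thesis by simp
qed

section \<open>Laplace transforms\<close>

text \<open>The power series of \<open>(exp z - 1 - z) / z^2\<close> has positive coefficients, so
  it is dominated term by term by its value at \<open>\<beta>\<close>.\<close>

lemma exp_diff_le:
  fixes z \<beta> :: real
  assumes "\<bar>z\<bar> \<le> \<beta>" "0 < \<beta>"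
  shows "exp z - 1 - z \<le> z\<^sup>2 * ((exp \<beta> - 1 - \<beta>) / \<beta>\<^sup>2)"
proof -
  have series: "(\<lambda>n. y ^ n * (y\<^sup>2 / fact (n + 2))) sums (exp y - 1 - y)" for y :: real
    using sums_split_initial_segment[OF exp_converges[of y], of 2]
    by (simp add: numeral_2_eq_2 field_simps power_add)
  have "exp z - 1 - z \<le> z\<^sup>2 / \<beta>\<^sup>2 * (exp \<beta> - 1 - \<beta>)"
  proof (rule sums_le[OF _ series sums_mult[OF series]])
    fix n
    have "z ^ n \<le> \<beta> ^ n" using assms by (metis abs_ge_self order_trans power_abs power_mono abs_ge_zero)
    then have "z ^ n * (z\<^sup>2 / fact (n + 2)) \<le> \<beta> ^ n * (z\<^sup>2 / fact (n + 2))"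
      by (intro mult_right_mono) auto
    then show "z ^ n * (z\<^sup>2 / fact (n + 2)) \<le> z\<^sup>2 / \<beta>\<^sup>2 * (\<beta> ^ n * (\<beta>\<^sup>2 / fact (n + 2)))"
      using assms by (simp add: mult.commute)
  qed
  then show ?thesis by simp
qed

text \<open>A chain rule with remainder: factor out \<open>exp (v x)\<close> and apply
  \<open>exp_diff_le\<close> to the jumps of \<open>v\<close>. The linear parts add up to the
  generator, the squares to twice the carre du champ.\<close>

lemma bd_generator_exp_le:
  assumes a: "0 \<le> a x" and b: "0 \<le> b x" "b 0 = 0"
    and v: "\<And>x. \<bar>v (x + 1) - v x\<bar> \<le> \<beta>" and \<beta>: "0 < \<beta>"
  shows "bd_generator a b (\<lambda>x. exp (v x)) x \<le>
    exp (v x) * (bd_generator a b v x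
      + 2 * carre_du_champ a b v x * ((exp \<beta> - 1 - \<beta>) / \<beta>\<^sup>2))"
proof -
  define \<phi> where "\<phi> = (exp \<beta> - 1 - \<beta>) / \<beta>\<^sup>2"
  have *: "exp (v y) - exp (v x) \<le> exp (v x) * (v y - v x + (v y - v x)\<^sup>2 * \<phi>)"
    if "\<bar>v y - v x\<bar> \<le> \<beta>" for y
  proof -
    have "exp (v y) - exp (v x) = exp (v x) * (exp (v y - v x) - 1)"
      by (simp add: right_diff_distrib mult_exp_exp)
    also have "\<dots> \<le> exp (v x) * (v y - v x + (v y - v x)\<^sup>2 * \<phi>)"
      using exp_diff_le[OF that \<beta>] by (intro mult_left_mono) (auto simp: \<phi>_def)
    finally show ?thesis .
  qed
  have "a x * (exp (v (x + 1)) - exp (v x))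
      \<le> a x * (exp (v x) * (v (x + 1) - v x + (v (x + 1) - v x)\<^sup>2 * \<phi>))"
    by (intro mult_left_mono * v a)
  moreover have "b x * (exp (v (x - 1)) - exp (v x))
      \<le> b x * (exp (v x) * (v (x - 1) - v x + (v (x - 1) - v x)\<^sup>2 * \<phi>))"
  proof (cases x)
    case (Suc k)
    then show ?thesis using v[of k] b by (intro mult_left_mono *) (auto simp: abs_minus_commute)
  qed (simp add: b)
  ultimately show ?thesis
    unfolding \<phi>_def[symmetric] bd_generator_def carre_du_champ_def by (simp add: algebra_simps)
qed


text \<open>Below \<open>N\<close> the truncated and the original rates agree. Two comparisons there
  relate the truncated solution to \<open>u\<close>, and \<open>G\<close> to the exponential of the
  truncated solution; the errors entering from the state \<open>N\<close> vanish in the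
  limit.\<close>

lemma laplace_bound:
  assumes a: "\<And>x. 0 \<le> a x" "antimono a" and b: "mono b" "b 0 = 0"
    and u: "backward_solution a b u" "\<And>t x. 0 \<le> t \<Longrightarrow> \<bar>u t x\<bar> \<le> C"
    and G: "backward_solution a b G" "\<And>t x. 0 \<le> t \<Longrightarrow> G t x \<le> D"
      "\<And>x. G 0 x = exp (\<theta> * u 0 x)"
    and L: "\<And>x. \<bar>u 0 (x + 1) - u 0 x\<bar> \<le> L" "0 < L"
    and V: "\<And>x. carre_du_champ a b (u 0) x \<le> V"
    and \<theta>: "0 < \<theta>" and t: "0 \<le> t"
  shows "G t x \<le> exp (\<theta> * u t x + t * (2 * V * ((exp (\<theta> * L) - 1 - \<theta> * L) / L\<^sup>2)))"
proof -
  have b_nonneg: "0 \<le> b x" for x using monoD[OF b(1), of 0 x] b(2) by simp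
  have a_le: "a x \<le> a 0" for x using antimonoD[OF a(2), of 0 x] by simp
  have C: "0 \<le> C" using u(2)[of 0 0] by linarith
  define c where "c = 2 * V * ((exp (\<theta> * L) - 1 - \<theta> * L) / L\<^sup>2)"
  define r where "r = real x + a 0 * t"
  have main: "G t x \<le> exp (\<theta> * (u t x + 2 * C * r / real N) + c * t) + max D 0 * r / real N"
    if N: "Suc x \<le> N" for N
  proof -
    text \<open>Truncating the death rates makes the generator bounded and preserves the
      monotonicity of the rates.\<close>
    define bN where "bN x = b (min x N)" for x
    have bN: "mono bN" "bN 0 = 0" "\<And>x. bN x \<le> b N" "\<And>x. 0 \<le> bN x"
      "\<And>x. bN x \<le> b x" "\<And>x. x \<le> N \<Longrightarrow> bN x = b x"
      using b b_nonneg by (auto simp: bN_def mono_def)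
    have gen: "bd_generator a b v x = bd_generator a bN v x" if "x < N" for v x
      using that by (simp add: bd_generator_def bN)
    obtain uN where uN: "uN 0 = u 0" "backward_solution a bN uN"
      and uN_exp: "\<And>t x. 0 \<le> t \<Longrightarrow> \<bar>uN t x\<bar> \<le> C * exp (2 * (a 0 + b N) * t)"
      using backward_solution_exists[of a "a 0" bN "b N" "u 0" C] a a_le bN u(2)[of 0] by auto
    \<comment> \<open>The series bound grows with \<open>N\<close> and time, but on a fixed time
      interval it is a constant. This admits the maximum principle, which then improves it to
      \<open>C\<close>.\<close>
    have uN_bound: "\<bar>uN s y\<bar> \<le> C * exp (2 * (a 0 + b N) * t)" if "0 \<le> s" "s \<le> t" for s y t
    proof -
      have "2 * (a 0 + b N) * s \<le> 2 * (a 0 + b N) * t"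
        using that a b_nonneg by (intro mult_left_mono) auto
      then show ?thesis using uN_exp[OF that(1), of y] C
        by (meson exp_le_cancel_iff mult_left_mono order_trans)
    qed
    have uN_le: "\<bar>uN s y\<bar> \<le> C" if "0 \<le> s" for s y
    proof (rule abs_leI)
      show "uN s y \<le> C"
        by (rule backward_solution_le[OF a(1) a_le bN(4,2) uN(2), where t = s])
          (use that uN u(2)[of 0] uN_bound in \<open>auto simp: abs_le_iff\<close>)
      show "- uN s y \<le> C"
        by (rule backward_solution_le[OF a(1) a_le bN(4,2) backward_solution_uminus[OF uN(2)], where t = s])
          (use that uN u(2)[of 0] uN_bound in \<open>auto simp: abs_le_iff\<close>)
    qed
    have uN_inc: "\<bar>uN s (y + 1) - uN s y\<bar> \<le> L" if "0 \<le> s" for s y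
    proof (rule abs_leI)
      show "uN s (y + 1) - uN s y \<le> L"
        by (rule backward_solution_increment_le[OF a bN(1,2) uN(2), where t = s and C = C])
          (use that uN L uN_le in \<open>auto simp: abs_le_iff\<close>)
      have "- uN s (y + 1) - - uN s y \<le> L"
        by (rule backward_solution_increment_le[OF a bN(1,2) backward_solution_uminus[OF uN(2)],
              where t = s and C = C])
          (use that uN L uN_le in \<open>auto simp: abs_le_iff\<close>)
      then show "- (uN s (y + 1) - uN s y) \<le> L" by simp
    qed
    have uN_V: "carre_du_champ a bN (uN s) y \<le> V" if "0 \<le> s" for s y
    proof (rule backward_solution_carre_du_champ_le[OF a bN(1,2,3) uN(2), where t = s and C = C])
      fix x
      \<comment> \<open>Truncation lowers the death rates and with them the carre du champ, so the
        initial bound \<open>V\<close> is inherited.\<close>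
      have "bN x * (u 0 (x - 1) - u 0 x)\<^sup>2 \<le> b x * (u 0 (x - 1) - u 0 x)\<^sup>2"
        using bN(5) by (rule mult_right_mono) simp
      then have "carre_du_champ a bN (u 0) x \<le> carre_du_champ a b (u 0) x"
        unfolding carre_du_champ_def by (intro mult_left_mono add_left_mono) auto
      also have "\<dots> \<le> V" by (rule V)
      finally show "carre_du_champ a bN (uN 0) x \<le> V" by (simp add: uN)
    qed (use that uN_le in auto)
    \<comment> \<open>Below \<open>N\<close> both functions solve the same equation with the same
      initial values, and at \<open>N\<close> they differ by at most \<open>2 * C\<close>. One
      direction suffices, since \<open>H\<close> increases with \<open>uN\<close>.\<close>
    have close: "uN t x - u t x \<le> 2 * C * (real x + a 0 * t) / real N"
    proof (rule comparison[where a = a and A = "a 0" and b = b and T = t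
          and w = "\<lambda>t x. uN t x - u t x"
          and w' = "\<lambda>t x. bd_generator a bN (uN t) x - bd_generator a b (u t) x"])
      fix s :: real assume "0 \<le> s"
      then show "uN s N - u s N \<le> 2 * C"
        using uN_le[of s N] u(2)[of s N] by linarith
    qed (use a a_le b b_nonneg N C t uN(1) in \<open>auto simp: bd_generator_diff gen
          intro!: continuous_intros backward_solutionD[OF u(1)] backward_solutionD[OF uN(2)]
            derivative_eq_intros\<close>)
    \<comment> \<open>The supersolution: the gradient bounds for \<open>uN\<close> hold at all
      times, so the growth rate \<open>c\<close> absorbs the second-order term of the generator on
      the exponential.\<close>
    define H where "H s y = exp (\<theta> * uN s y + c * s)" for s y
    have "G t x - H t x \<le> max D 0 * (real x + a 0 * t) / real N"
    proof (rule comparison[where a = a and A = "a 0" and b = b and T = t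
          and w = "\<lambda>t x. G t x - H t x"
          and w' = "\<lambda>t x. bd_generator a b (G t) x
            - H t x * (\<theta> * bd_generator a bN (uN t) x + c)"])
      fix s y assume s: "0 \<le> s" "s < t" "y < N"
      show "((\<lambda>r. G r y - H r y) has_real_derivative bd_generator a b (G s) y
            - H s y * (\<theta> * bd_generator a bN (uN s) y + c)) (at_right s)"
        unfolding H_def
        by (auto intro!: derivative_eq_intros backward_solutionD(2)[OF G(1) s(1)]
          backward_solutionD(2)[OF uN(2) s(1)])
      \<comment> \<open>The exponent of \<open>H\<close> at the fixed time \<open>s\<close>. The
        summand \<open>c * s\<close> is constant in the state and affects neither the generator nor
        the carre du champ.\<close>
      define v where "v y = \<theta> * uN s y + c * s" for y
      have v: "bd_generator a bN v y = \<theta> * bd_generator a bN (uN s) y"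
        "carre_du_champ a bN v y = \<theta>\<^sup>2 * carre_du_champ a bN (uN s) y"
        by (simp_all add: v_def bd_generator_def carre_du_champ_def algebra_simps power2_eq_square)
      have v_inc: "\<bar>v (y + 1) - v y\<bar> \<le> \<theta> * L" for y
      proof -
        have "\<bar>v (y + 1) - v y\<bar> = \<theta> * \<bar>uN s (y + 1) - uN s y\<bar>"
          using \<theta> by (simp add: v_def right_diff_distrib[symmetric] abs_mult del: right_diff_distrib)
        then show ?thesis using \<theta> uN_inc[OF s(1)] by (simp add: mult_left_mono)
      qed
      have "bd_generator a b (H s) y \<le> H s y * (bd_generator a bN v y
          + 2 * carre_du_champ a bN v y * ((exp (\<theta> * L) - 1 - \<theta> * L) / (\<theta> * L)\<^sup>2))"
        unfolding gen[OF s(3)] H_def v_def[symmetric]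
        by (rule bd_generator_exp_le[of a y bN v, OF a(1) bN(4,2) v_inc]) (use \<theta> L in simp)
      also have "2 * carre_du_champ a bN v y * ((exp (\<theta> * L) - 1 - \<theta> * L) / (\<theta> * L)\<^sup>2)
          = 2 * carre_du_champ a bN (uN s) y * ((exp (\<theta> * L) - 1 - \<theta> * L) / L\<^sup>2)"
        using \<theta> by (simp add: v power_mult_distrib)
      also have "\<dots> \<le> c"
        unfolding c_def using uN_V[OF s(1)] exp_ge_add_one_self[of "\<theta> * L"]
        by (intro mult_right_mono mult_left_mono divide_nonneg_nonneg) (simp_all add: le_diff_eq add.commute)
      finally have "bd_generator a b (H s) y \<le> H s y * (\<theta> * bd_generator a bN (uN s) y + c)"
        by (simp add: H_def[abs_def] v)
      then show "bd_generator a b (G s) y - H s y * (\<theta> * bd_generator a bN (uN s) y + c)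
        \<le> bd_generator a b (\<lambda>x. G s x - H s x) y"
        by (simp add: bd_generator_diff)
    next
      \<comment> \<open>Since \<open>H\<close> is positive, the upper bound on \<open>G\<close>
        suffices; \<open>max D 0\<close> provides the nonnegative constant that
        \<open>comparison\<close> asks for.\<close>
      fix s :: real assume "0 \<le> s"
      then show "G s N - H s N \<le> max D 0"
        using G(2)[of s N] by (simp add: H_def le_max_iff_disj) (smt (verit) exp_gt_zero)
    next
      fix y show "continuous_on {0..t} (\<lambda>t. G t y - H t y)"
        unfolding H_def
        by (intro continuous_intros backward_solutionD[OF G(1)] backward_solutionD[OF uN(2)])
    qed (use a a_le b b_nonneg N t uN(1) G(3) in \<open>auto simp: H_def\<close>)
    moreover have "H t x \<le> exp (\<theta> * (u t x + 2 * C * r / real N) + c * t)"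
      using close \<theta> by (simp add: H_def r_def)
    ultimately show ?thesis by (simp add: r_def)
  qed
  have lim: "(\<lambda>N. k * r / real N) \<longlonglongrightarrow> 0" for k by (rule lim_const_over_n)
  have "(\<lambda>N. exp (\<theta> * (u t x + 2 * C * r / real N) + c * t) + max D 0 * r / real N)
    \<longlonglongrightarrow> exp (\<theta> * (u t x + 0) + c * t) + 0"
    by (intro tendsto_intros lim)
  then have "G t x \<le> exp (\<theta> * (u t x + 0) + c * t) + 0"
    by (rule LIMSEQ_le_const) (use main in blast)
  then show ?thesis by (simp add: c_def mult.commute)
qed


section \<open>Semigroups of probability mass functions\<close>

text \<open>Values in \<open>pmf\<close> build in total mass one, so the probabilities of finitely
  many states control the mass of all the others.\<close>

definition bd_semigroup ::
  "(nat \<Rightarrow> real) \<Rightarrow> (nat \<Rightarrow> real) \<Rightarrow> (real \<Rightarrow> nat \<Rightarrow> nat pmf) \<Rightarrow> bool" where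
  "bd_semigroup a b K \<longleftrightarrow>
     (\<forall>x. K 0 x = return_pmf x) \<and>
     (\<forall>s\<ge>0. \<forall>t\<ge>0. \<forall>x. K (s + t) x = bind_pmf (K s x) (K t)) \<and>
     has_bd_rates a b (\<lambda>t x. pmf (K t x))"

lemma integrable_pmf_bounded:
  fixes v :: "'a \<Rightarrow> real"
  assumes "\<And>x. \<bar>v x\<bar> \<le> C"
  shows "integrable (measure_pmf p) v"
  using assms by (intro measure_pmf.integrable_const_bound[where B = C]) auto

lemma abs_expectation_le:
  fixes v :: "'a \<Rightarrow> real"
  assumes "\<And>x. \<bar>v x\<bar> \<le> C"
  shows "\<bar>measure_pmf.expectation p v\<bar> \<le> C"
proof -
  have "\<bar>measure_pmf.expectation p v\<bar> \<le> measure_pmf.expectation p (\<lambda>x. \<bar>v x\<bar>)"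
    by (rule integral_abs_bound)
  also have "\<dots> \<le> measure_pmf.expectation p (\<lambda>_. C)"
    using assms by (intro integral_mono integrable_pmf_bounded[of _ C]) (auto intro: order_trans[OF abs_ge_zero])
  finally show ?thesis by simp
qed

lemma expectation_bind_pmf:
  fixes v :: "'b \<Rightarrow> real"
  assumes "\<And>x. \<bar>v x\<bar> \<le> C"
  shows "measure_pmf.expectation (bind_pmf p q) v
    = measure_pmf.expectation p (\<lambda>x. measure_pmf.expectation (q x) v)"
  unfolding measure_pmf_bind using assms
  by (intro integral_bind[where K = "count_space UNIV" and B' = 1 and B = C])
    (auto intro!: measure_pmf.emeasure_le_1 simp: space_subprob_algebra subprob_space_measure_pmf)

text \<open>The rates sum to zero over the neighbours of \<open>x\<close>, so the mass that leaves them up to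
  time \<open>t\<close> is \<open>o(t)\<close>.\<close>

lemma bd_semigroup_deriv_0:
  assumes K: "bd_semigroup a b K" and v: "\<And>x. \<bar>v x\<bar> \<le> C"
  shows "((\<lambda>t. measure_pmf.expectation (K t x) v) has_real_derivative bd_generator a b v x) (at_right 0)"
proof -
  have K0: "K 0 x = return_pmf x" using K by (auto simp: bd_semigroup_def)
  have KD: "((\<lambda>t. pmf (K t x) y) has_real_derivative bd_generator a b (indicator {y}) x) (at_right 0)" for y
    using K by (auto simp: bd_semigroup_def has_bd_rates_def)
  \<comment> \<open>For \<open>x = 0\<close> this is \<open>{0, 1}\<close>, and the death term of
    the generator is zero because \<open>0 - 1 = 0\<close>.\<close>
  define S where "S = {x - 1, x, x + 1}"
  have S: "finite S" "x \<in> S" by (auto simp: S_def)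
  have sum_S: "(\<Sum>z\<in>S. bd_generator a b (indicator {z}) x * g z) = bd_generator a b g x" for g
    by (cases x) (auto simp: S_def bd_generator_def algebra_simps)
  \<comment> \<open>\<open>R\<close> is the contribution from outside \<open>S\<close> and
    \<open>m\<close> the mass there. As \<open>m\<close> has value and right derivative 0 at time 0,
    the bound \<open>\<bar>R t\<bar> \<le> C * m t\<close> removes \<open>R\<close> from the
    derivative.\<close>
  define R where "R t = measure_pmf.expectation (K t x) (\<lambda>z. v z * indicator (- S) z)" for t
  define m where "m t = 1 - (\<Sum>z\<in>S. pmf (K t x) z)" for t
  have split: "measure_pmf.expectation (K t x) v = (\<Sum>z\<in>S. pmf (K t x) z * v z) + R t" for t
  proof -
    have "measure_pmf.expectation (K t x) v =
      measure_pmf.expectation (K t x) (\<lambda>z. v z * indicator S z + v z * indicator (- S) z)"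
      by (intro Bochner_Integration.integral_cong) (auto simp: indicator_def)
    also have "\<dots> = measure_pmf.expectation (K t x) (\<lambda>z. v z * indicator S z) + R t"
      unfolding R_def using v order_trans[OF abs_ge_zero v]
      by (intro Bochner_Integration.integral_add integrable_pmf_bounded[of _ C]) (auto simp: indicator_def)
    also have "measure_pmf.expectation (K t x) (\<lambda>z. v z * indicator S z) = (\<Sum>z\<in>S. pmf (K t x) z * v z)"
      by (subst integral_measure_pmf[OF S(1)]) (auto simp: indicator_def intro!: sum.cong)
    finally show ?thesis .
  qed
  have R_le: "\<bar>R t\<bar> \<le> C * m t" for t
  proof -
    have "\<bar>R t\<bar> \<le> measure_pmf.expectation (K t x) (\<lambda>z. \<bar>v z * indicator (- S) z\<bar>)"
      unfolding R_def by (rule integral_abs_bound)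
    also have "\<dots> \<le> measure_pmf.expectation (K t x) (\<lambda>z. C * indicator (- S) z)"
      using v order_trans[OF abs_ge_zero v]
      by (intro integral_mono integrable_pmf_bounded[of _ C]) (auto simp: indicator_def)
    also have "\<dots> = C * measure (K t x) (- S)" by simp
    also have "measure (K t x) (- S) = m t"
      using measure_pmf.prob_compl[of S "K t x"] S(1)
      by (simp add: Compl_eq_Diff_UNIV m_def measure_measure_pmf_finite)
    finally show ?thesis .
  qed
  have m_deriv: "(m has_real_derivative 0) (at_right 0)"
  proof -
    have "(m has_real_derivative - (\<Sum>z\<in>S. bd_generator a b (indicator {z}) x)) (at_right 0)"
      unfolding m_def by (auto intro!: derivative_eq_intros KD)
    then show ?thesis using sum_S[of "\<lambda>_. 1"] by simp
  qed
  have m0: "m 0 = 0" using S by (simp add: m_def K0 sum.delta indicator_def)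
  have R0: "R 0 = 0" using S(2) by (simp add: R_def K0)
  have "(R has_real_derivative 0) (at_right 0)"
    unfolding has_field_derivative_iff
  proof (rule Lim_null_comparison)
    have "((\<lambda>t. m t / t) \<longlongrightarrow> 0) (at_right 0)"
      using m_deriv by (simp add: has_field_derivative_iff m0)
    from tendsto_mult_left[OF this, of C]
    show "((\<lambda>t. C * (m t / t)) \<longlongrightarrow> 0) (at_right 0)" by simp
    show "eventually (\<lambda>t. norm ((R t - R 0) / (t - 0)) \<le> C * (m t / t)) (at_right 0)"
      using R_le by (auto simp: R0 eventually_at_right_field divide_right_mono abs_divide
          intro!: exI[of _ 1])
  qed
  then have "((\<lambda>t. (\<Sum>z\<in>S. pmf (K t x) z * v z) + R t) has_real_derivative
      (\<Sum>z\<in>S. bd_generator a b (indicator {z}) x * v z) + 0) (at_right 0)"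
    by (auto intro!: derivative_eq_intros KD)
  then show ?thesis unfolding split sum_S by simp
qed

text \<open>By the semigroup property the right derivative at \<open>t\<close> is the one at time 0
  for the bounded function \<open>u t\<close>. Continuity, also from the left, comes from a modulus
  that does not depend on \<open>t\<close>.\<close>

lemma bd_semigroup_backward_solution:
  assumes K: "bd_semigroup a b K" and v: "\<And>x. \<bar>v x\<bar> \<le> C"
  shows "backward_solution a b (\<lambda>t x. measure_pmf.expectation (K t x) v)"
proof -
  define u where "u t x = measure_pmf.expectation (K t x) v" for t x
  have u_le: "\<bar>u t x\<bar> \<le> C" for t x
    unfolding u_def by (rule abs_expectation_le[OF v])
  have u_add: "u (s + t) x = measure_pmf.expectation (K s x) (u t)" if "0 \<le> s" "0 \<le> t" for s t x
    using K that unfolding bd_semigroup_def u_def[abs_def] by (simp add: expectation_bind_pmf[OF v])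
  have deriv: "((\<lambda>s. u s x) has_real_derivative bd_generator a b (u t) x) (at_right t)"
    if t: "0 \<le> t" for t x
  proof -
    let ?F = "\<lambda>s. measure_pmf.expectation (K s x) (u t)"
    have image: "(\<lambda>s. s - t) ` {t<..} = {0<..}"
      by (force simp: image_iff intro: bexI[of _ "_ + t"])
    have "((?F \<circ> (\<lambda>s. s - t)) has_real_derivative bd_generator a b (u t) x * 1) (at_right t)"
      using bd_semigroup_deriv_0[OF K u_le]
      by (intro DERIV_image_chain) (auto simp: image intro!: derivative_eq_intros)
    then have "((\<lambda>s. ?F (s - t)) has_real_derivative bd_generator a b (u t) x) (at_right t)"
      by (simp add: o_def)
    moreover have "?F (s - t) = u s x" if "t \<le> s" for s
      using u_add[of "s - t" t x] that t by simp
    ultimately show ?thesis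
      by (subst (asm) has_field_derivative_cong_eventually[where g = "\<lambda>s. u s x"])
        (use K in \<open>auto simp: eventually_at_right_field bd_semigroup_def intro!: exI[of _ "t + 1"]\<close>)
  qed
  have "continuous_on {0..} (\<lambda>t. u t x)" for x
  proof -
    \<comment> \<open>Only the event of being away from \<open>x\<close> at time \<open>h\<close>
      contributes to the change over a time \<open>h\<close>, and its probability tends to 0 with
      \<open>h\<close>.\<close>
    define \<omega> where "\<omega> h = 2 * C * (1 - pmf (K h x) x)" for h
    have step: "\<bar>u (h + s) x - u s x\<bar> \<le> \<omega> h" if "0 \<le> h" "0 \<le> s" for h s
    proof -
      have "u (h + s) x - u s x = measure_pmf.expectation (K h x) (\<lambda>z. u s z - u s x)"
        using that u_le by (simp add: u_add integrable_pmf_bounded[of _ C])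
      then have "\<bar>u (h + s) x - u s x\<bar> \<le> measure_pmf.expectation (K h x) (\<lambda>z. \<bar>u s z - u s x\<bar>)"
        by (simp add: integral_abs_bound)
      also have "\<dots> \<le> measure_pmf.expectation (K h x) (\<lambda>z. 2 * C * indicator (- {x}) z)"
      proof (intro integral_mono integrable_pmf_bounded[of _ "2 * C"])
        fix z
        have *: "\<bar>u s z - u s x\<bar> \<le> 2 * C" using u_le[of s z] u_le[of s x] by linarith
        then show "\<bar>\<bar>u s z - u s x\<bar>\<bar> \<le> 2 * C" by simp
        show "\<bar>2 * C * indicator (- {x}) z\<bar> \<le> 2 * C" using * by (auto simp: indicator_def)
        show "\<bar>u s z - u s x\<bar> \<le> 2 * C * indicator (- {x}) z" using * by (auto simp: indicator_def)
      qed
      also have "\<dots> = \<omega> h"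
        using measure_pmf.prob_compl[of "{x}" "K h x"]
        by (simp add: Compl_eq_Diff_UNIV \<omega>_def measure_pmf_single)
      finally show ?thesis .
    qed
    have "((\<lambda>h. pmf (K h x) x) \<longlongrightarrow> pmf (K 0 x) x) (at_right 0)"
      using K DERIV_continuous unfolding bd_semigroup_def has_bd_rates_def continuous_within
      by blast
    then have "((\<lambda>h. \<omega> h) \<longlongrightarrow> 2 * C * (1 - 1)) (at_right 0)"
      using K unfolding \<omega>_def bd_semigroup_def by (intro tendsto_intros) auto
    then have \<omega>: "(\<omega> \<longlongrightarrow> 0) (at_right 0)" by simp
    show ?thesis
      unfolding continuous_on_iff
    proof (intro ballI allI impI)
      fix t e :: real assume "t \<in> {0..}" "0 < e"
      from order_tendstoD(2)[OF \<omega> \<open>0 < e\<close>] obtain d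
        where d: "0 < d" "\<And>h. 0 < h \<Longrightarrow> h < d \<Longrightarrow> \<omega> h < e"
        by (auto simp: eventually_at_right_field)
      have "dist (u s x) (u t x) < e" if "s \<in> {0..}" "dist s t < d" for s
      proof (cases s t rule: linorder_cases)
        case less
        then show ?thesis using step[of "t - s" s] d(2)[of "t - s"] that
          by (simp add: dist_real_def abs_minus_commute)
      next
        case greater
        then show ?thesis using step[of "s - t" t] d(2)[of "s - t"] that \<open>t \<in> {0..}\<close>
          by (simp add: dist_real_def)
      qed (use \<open>0 < e\<close> in simp)
      then show "\<exists>d>0. \<forall>s\<in>{0..}. dist s t < d \<longrightarrow> dist (u s x) (u t x) < e"
        using \<open>0 < d\<close> by blast
    qed
  qed
  with deriv show ?thesis unfolding backward_solution_def u_def by blast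
qed

section \<open>Exponential and first moments of the semigroup\<close>

lemma bd_semigroup_laplace:
  assumes K: "bd_semigroup a b K"
    and a: "\<And>x. 0 \<le> a x" "antimono a" and b: "mono b" "b 0 = 0"
    and f: "\<And>x. \<bar>f x\<bar> \<le> C" "\<And>x. \<bar>f (x + 1) - f x\<bar> \<le> L" "0 < L"
    and V: "\<And>x. carre_du_champ a b f x \<le> V"
    and \<theta>: "0 < \<theta>" and t: "0 \<le> t"
  shows "measure_pmf.expectation (K t x) (\<lambda>z. exp (\<theta> * f z)) \<le>
    exp (\<theta> * measure_pmf.expectation (K t x) f
      + t * (2 * V * ((exp (\<theta> * L) - 1 - \<theta> * L) / L\<^sup>2)))"
proof -
  have K0: "K 0 x = return_pmf x" for x using K by (auto simp: bd_semigroup_def)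
  have exp_le: "\<bar>exp (\<theta> * f x)\<bar> \<le> exp (\<theta> * C)" for x
    using f(1)[of x] \<theta> by (auto simp: abs_le_iff)
  show ?thesis
  proof (rule laplace_bound[OF a b bd_semigroup_backward_solution[OF K f(1)] _
        bd_semigroup_backward_solution[OF K exp_le], where C = C])
    show "measure_pmf.expectation (K t x) (\<lambda>z. exp (\<theta> * f z)) \<le> exp (\<theta> * C)" for t x
      using abs_expectation_le[of "\<lambda>z. exp (\<theta> * f z)", OF exp_le, of "K t x"] by linarith
  qed (use f V \<theta> t in \<open>simp_all add: K0 abs_expectation_le\<close>)
qed

text \<open>The drift \<open>a y - b y\<close> is at most \<open>A\<close>, so
  \<open>x + A * t\<close> is a supersolution. It dominates the means of the bounded functions
  \<open>min z k\<close> uniformly in \<open>k\<close>, and monotone convergence applies.\<close>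

lemma bd_semigroup_integrable:
  assumes K: "bd_semigroup a b K"
    and a: "\<And>x. 0 \<le> a x" "\<And>x. a x \<le> A" and b: "\<And>x. 0 \<le> b x" "b 0 = 0"
    and t: "0 \<le> t"
  shows "integrable (measure_pmf (K t x)) real"
proof -
  define g where "g k z = min (real z) (real k)" for k z :: nat
  have g: "\<bar>g k z\<bar> \<le> real k" for k z by (auto simp: g_def)
  define u where "u k t x = measure_pmf.expectation (K t x) (g k)" for k t x
  have u: "backward_solution a b (u k)" for k
    unfolding u_def by (rule bd_semigroup_backward_solution[OF K g])
  have A: "0 \<le> A" using a[of 0] by linarith
  have bound: "u k t x - (real x + A * t) \<le> 0" for k
  proof (rule maximum_principle[where a = a and A = A and b = b and T = t and C = "real k"
        and w = "\<lambda>t x. u k t x - (real x + A * t)" and w' = "\<lambda>t x. bd_generator a b (u k t) x - A"])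
    fix s y
    have "bd_generator a b (\<lambda>x. real x + A * s) y \<le> A"
    proof (cases y)
      case (Suc j)
      then show ?thesis using a(2)[of y] b(1)[of y] by (simp add: bd_generator_def)
    qed (use a(2)[of 0] b in \<open>simp add: bd_generator_def\<close>)
    then show "bd_generator a b (u k s) y - A \<le> bd_generator a b (\<lambda>x. u k s x - (real x + A * s)) y"
      by (simp add: bd_generator_diff)
    assume "0 \<le> s"
    then have "0 \<le> A * s" using A by simp
    then show "u k s y - (real y + A * s) \<le> real k"
      using abs_expectation_le[of "g k", OF g, of "K s y"] unfolding u_def by linarith
  next
    show "u k 0 x - (real x + A * 0) \<le> 0" for x
      using K by (simp add: bd_semigroup_def u_def g_def)
  qed (use a b t in \<open>auto intro!: continuous_intros backward_solutionD[OF u] derivative_eq_intros\<close>)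
  have mono: "mono (\<lambda>k. u k t x)"
    unfolding u_def mono_def
    by (auto intro!: integral_mono integrable_pmf_bounded[OF g] simp: g_def)
  obtain l where l: "(\<lambda>k. u k t x) \<longlonglongrightarrow> l"
  proof (rule incseq_convergent[OF mono])
    show "\<forall>k. u k t x \<le> real x + A * t" using bound by simp
  qed blast
  show ?thesis
  proof (rule integrable_monotone_convergence)
    show "integrable (measure_pmf (K t x)) (g k)" for k by (rule integrable_pmf_bounded[OF g])
    show "(\<lambda>k. measure_pmf.expectation (K t x) (g k)) \<longlonglongrightarrow> l" using l by (simp add: u_def)
    have "(\<lambda>k. g k z) \<longlonglongrightarrow> real z" for z
      by (rule tendsto_eventually) (auto simp: g_def eventually_sequentially intro!: exI[of _ z])
    then show "AE z in K t x. (\<lambda>k. g k z) \<longlonglongrightarrow> real z" by simp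
    show "AE z in K t x. mono (\<lambda>k. g k z)" by (auto simp: mono_def g_def)
  qed simp
qed


section \<open>Truncation of the function and the Chernoff bound\<close>

lemma carre_du_champ_mono:
  assumes "0 \<le> a x" "0 \<le> b x" "\<And>y. \<bar>g y - g x\<bar> \<le> \<bar>f y - f x\<bar>"
  shows "carre_du_champ a b g x \<le> carre_du_champ a b f x"
  unfolding carre_du_champ_def using assms
  by (intro mult_left_mono add_mono) (auto simp: abs_le_square_iff)

text \<open>Since \<open>f\<close> may be unbounded, the Laplace bound is applied to
  \<open>f\<close> clamped to \<open>- r n\<close> and \<open>r n\<close>. Clamping is a
  contraction, so \<open>L\<close> and \<open>V\<close> still serve; the mean and the tail are then
  passed to the limit.\<close>

lemma bd_semigroup_tail:
  assumes K: "bd_semigroup a b K"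
    and a: "\<And>x. 0 \<le> a x" "antimono a" and b: "mono b" "b 0 = 0"
    and f: "\<And>x. \<bar>f (x + 1) - f x\<bar> \<le> L" "0 < L"
    and V: "\<And>x. carre_du_champ a b f x \<le> V"
    and \<theta>: "0 < \<theta>" and t: "0 \<le> t"
  shows "measure (K t x) {z. y \<le> f z - measure_pmf.expectation (K t x) f} \<le>
    exp (- (\<theta> * y) + t * (2 * V * ((exp (\<theta> * L) - 1 - \<theta> * L) / L\<^sup>2)))"
proof -
  have b_nonneg: "0 \<le> b x" for x using monoD[OF b(1), of 0 x] b(2) by simp
  define c where "c = t * (2 * V * ((exp (\<theta> * L) - 1 - \<theta> * L) / L\<^sup>2))"
  define \<mu> where "\<mu> = measure_pmf.expectation (K t x) f"
  define A where "A = {z. y \<le> f z - \<mu>}"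
  have f_le: "\<bar>f z\<bar> \<le> \<bar>f 0\<bar> + L * real z" for z
  proof (induction z)
    case (Suc z)
    have "\<bar>f (Suc z)\<bar> \<le> \<bar>f z\<bar> + L" using f(1)[of z] by simp
    with Suc show ?case by (simp add: algebra_simps)
  qed simp
  have int: "integrable (measure_pmf (K t x)) (\<lambda>z. \<bar>f 0\<bar> + L * real z)"
    using bd_semigroup_integrable[OF K a(1) _ b_nonneg b(2) t, of "a 0" x] antimonoD[OF a(2), of 0]
    by simp
  \<comment> \<open>By the Lipschitz bound \<open>r n\<close> dominates \<open>f\<close> on
    \<open>{..n}\<close>, so clamping changes nothing there.\<close>
  define r where "r n = \<bar>f 0\<bar> + L * real n" for n
  define g where "g n z = max (- r n) (min (r n) (f z))" for n z
  have r: "0 \<le> r n" for n using f by (simp add: r_def)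
  have g_le: "\<bar>g n z\<bar> \<le> r n" for n z using r[of n] by (auto simp: g_def)
  have g_lip: "\<bar>g n z - g n z'\<bar> \<le> \<bar>f z - f z'\<bar>" for n z z' by (auto simp: g_def)
  have g_eq: "g n z = f z" if "z \<le> n" for n z
  proof -
    have "L * real z \<le> L * real n" using that f by (intro mult_left_mono) auto
    then show ?thesis using f_le[of z] by (auto simp: g_def r_def)
  qed
  define \<mu>' where "\<mu>' n = measure_pmf.expectation (K t x) (g n)" for n
  have \<mu>': "\<mu>' \<longlonglongrightarrow> \<mu>"
    unfolding \<mu>'_def \<mu>_def
  proof (rule integral_dominated_convergence[where w = "\<lambda>z. \<bar>f 0\<bar> + L * real z"])
    have "(\<lambda>n. g n z) \<longlonglongrightarrow> f z" for z
      by (rule tendsto_eventually) (auto simp: eventually_sequentially g_eq intro!: exI[of _ z])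
    then show "AE z in K t x. (\<lambda>n. g n z) \<longlonglongrightarrow> f z" by simp
    have "\<bar>g n z\<bar> \<le> \<bar>f z\<bar>" for n z using r[of n] by (auto simp: g_def)
    then have "\<bar>g n z\<bar> \<le> \<bar>f 0\<bar> + L * real z" for n z using f_le[of z] order_trans by blast
    then show "AE z in K t x. norm (g n z) \<le> \<bar>f 0\<bar> + L * real z" for n by simp
  qed (use int in auto)
  \<comment> \<open>Markov's inequality for \<open>exp (\<theta> * g n z)\<close>: on
    \<open>{..n}\<close> it equals \<open>exp (\<theta> * f z)\<close>. The threshold is centred at
    \<open>\<mu>\<close>, the Laplace bound at \<open>\<mu>' n\<close>; the gap closes in the
    limit.\<close>
  have main: "measure (K t x) (A \<inter> {..n}) \<le> exp (\<theta> * \<mu>' n + c - \<theta> * (\<mu> + y))" for n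
  proof -
    have exp_le: "\<bar>exp (\<theta> * g n z)\<bar> \<le> exp (\<theta> * r n)" for z
      using g_le[of n z] \<theta> by (auto simp: abs_le_iff)
    have "exp (\<theta> * (\<mu> + y)) * measure (K t x) (A \<inter> {..n})
        = measure_pmf.expectation (K t x) (\<lambda>z. exp (\<theta> * (\<mu> + y)) * indicator (A \<inter> {..n}) z)"
      by simp
    also have "\<dots> \<le> measure_pmf.expectation (K t x) (\<lambda>z. exp (\<theta> * g n z))"
    proof (rule integral_mono)
      show "integrable (measure_pmf (K t x)) (\<lambda>z. exp (\<theta> * g n z))"
        by (rule integrable_pmf_bounded[OF exp_le])
      show "integrable (measure_pmf (K t x)) (\<lambda>z. exp (\<theta> * (\<mu> + y)) * indicator (A \<inter> {..n}) z)"
        by (rule integrable_pmf_bounded[of _ "exp (\<theta> * (\<mu> + y))"]) (auto simp: indicator_def)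
      show "exp (\<theta> * (\<mu> + y)) * indicator (A \<inter> {..n}) z \<le> exp (\<theta> * g n z)" for z
        using \<theta> by (auto simp: indicator_def A_def g_eq)
    qed
    also have "\<dots> \<le> exp (\<theta> * \<mu>' n + c)"
      unfolding \<mu>'_def c_def
    proof (rule bd_semigroup_laplace[OF K a b g_le _ f(2) _ \<theta> t])
      show "\<bar>g n (z + 1) - g n z\<bar> \<le> L" for z using g_lip[of n "z + 1" z] f(1)[of z] by linarith
      show "carre_du_champ a b (g n) z \<le> V" for z
        using carre_du_champ_mono[of a z b "g n" f] a b_nonneg g_lip V[of z] by fastforce
    qed
    finally show ?thesis
      by (simp add: exp_diff field_simps)
  qed
  have "(\<lambda>n. measure (K t x) (A \<inter> {..n})) \<longlonglongrightarrow> measure (K t x) (\<Union>n. A \<inter> {..n})"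
    by (rule measure_pmf.finite_Lim_measure_incseq) (auto simp: incseq_def)
  also have "(\<Union>n. A \<inter> {..n}) = A" by auto
  finally have lim: "(\<lambda>n. measure (K t x) (A \<inter> {..n})) \<longlonglongrightarrow> measure (K t x) A" .
  have "(\<lambda>n. exp (\<theta> * \<mu>' n + c - \<theta> * (\<mu> + y))) \<longlonglongrightarrow> exp (\<theta> * \<mu> + c - \<theta> * (\<mu> + y))"
    by (intro tendsto_intros \<mu>')
  from LIMSEQ_le[OF lim this] main
  have "measure (K t x) A \<le> exp (\<theta> * \<mu> + c - \<theta> * (\<mu> + y))" by blast
  then show ?thesis by (simp add: A_def \<mu>_def c_def algebra_simps)
qed

text \<open>Equality holds at 0, and the difference has nonnegative derivative because
  \<open>ln (1 + r) \<ge> r / (1 + r)\<close>. Equivalently, Bennett's exponent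
  \<open>(1 + s) * ln (1 + s) - s\<close> is at least \<open>s / 2 * ln (1 + s)\<close>.\<close>

lemma ln_add_one_ge:
  fixes s :: real
  assumes "0 \<le> s"
  shows "s \<le> (1 + s / 2) * ln (1 + s)"
proof -
  let ?h = "\<lambda>s::real. (1 + s / 2) * ln (1 + s) - s"
  have "?h 0 \<le> ?h s"
  proof (rule DERIV_nonneg_imp_nondecreasing[OF assms])
    fix r :: real assume r: "0 \<le> r" "r \<le> s"
    have "- ln (1 + r) \<le> inverse (1 + r) - 1"
      using r ln_le_minus_one[of "inverse (1 + r)"] by (simp add: ln_inverse)
    then have "0 \<le> ln (1 + r) / 2 + (1 + r / 2) / (1 + r) - 1"
      using r by (simp add: field_simps)
    moreover have "(?h has_real_derivative ln (1 + r) / 2 + (1 + r / 2) / (1 + r) - 1) (at r)"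
      using r by (auto intro!: derivative_eq_intros)
    ultimately show "\<exists>d. (?h has_real_derivative d) (at r) \<and> 0 \<le> d" by blast
  qed
  then show ?thesis by simp
qed

lemma bd_semigroup_deviation:
  assumes K: "bd_semigroup a b K"
    and a: "\<And>x. 0 \<le> a x" "antimono a" and b: "mono b" "b 0 = 0"
    and f: "\<And>x. \<bar>f (x + 1) - f x\<bar> \<le> L" "0 < L"
    and V: "\<And>x. carre_du_champ a b f x \<le> V" "0 < V"
    and t: "0 < t" and y: "0 < y"
  shows "measure (K t x) {z. y \<le> f z - measure_pmf.expectation (K t x) f} \<le>
    exp (- (y / (2 * L)) * ln (1 + y * L / (2 * t * V)))"
proof -
  define s where "s = y * L / (2 * t * V)"
  define l where "l = ln (1 + s)"
  have s: "0 < s" using y f V t by (simp add: s_def)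
  then have l: "0 < l" by (simp add: l_def)
  have y_eq: "y = s * (2 * t * V) / L" using f V t by (simp add: s_def)
  text \<open>The optimal \<open>\<theta>\<close> in the Chernoff bound.\<close>
  define \<theta> where "\<theta> = l / L"
  \<comment> \<open>Since \<open>exp (\<theta> * L) = 1 + s\<close>, every term is a multiple of
    \<open>2 * t * V / L^2\<close> and Bennett's exponent appears.\<close>
  have "- (\<theta> * y) + t * (2 * V * ((exp (\<theta> * L) - 1 - \<theta> * L) / L\<^sup>2))
      = - (2 * t * V / L\<^sup>2) * ((1 + s) * l - s)"
    using f s by (simp add: \<theta>_def y_eq l_def field_simps power2_eq_square)
  also have "\<dots> \<le> - (2 * t * V / L\<^sup>2) * (s / 2 * l)"
    using ln_add_one_ge[of s] s V t unfolding l_def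
    by (intro mult_left_mono_neg) (auto simp: algebra_simps)
  also have "\<dots> = - (y / (2 * L)) * l"
    using f by (simp add: y_eq field_simps power2_eq_square)
  finally have "exp (- (\<theta> * y) + t * (2 * V * ((exp (\<theta> * L) - 1 - \<theta> * L) / L\<^sup>2)))
    \<le> exp (- (y / (2 * L)) * l)" by simp
  moreover have "0 < \<theta>" using l f by (simp add: \<theta>_def)
  ultimately show ?thesis
    using bd_semigroup_tail[OF K a b f V(1), of \<theta> t x y] t
    unfolding s_def[symmetric] l_def[symmetric] by linarith
qed

section \<open>The semigroup of a birth-death process\<close>

text \<open>The value is meaningful for \<open>t \<ge> 0\<close>, where \<open>X t\<close> is
  measurable.\<close>

definition law :: "(nat \<Rightarrow> 'w measure) \<Rightarrow> (real \<Rightarrow> 'w \<Rightarrow> nat) \<Rightarrow> real \<Rightarrow> nat \<Rightarrow> nat pmf" where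
  "law P X t x = Abs_pmf (distr (P x) (count_space UNIV) (X t))"

lemma measure_pmf_law:
  assumes "markov_family P X" "0 \<le> t"
  shows "measure_pmf (law P X t x) = distr (P x) (count_space UNIV) (X t)"
proof -
  have X: "X t \<in> P x \<rightarrow>\<^sub>M count_space UNIV" and P: "prob_space (P x)"
    using assms by (auto simp: markov_family_def)
  let ?D = "distr (P x) (count_space UNIV) (X t)"
  interpret D: prob_space ?D using prob_space.prob_space_distr[OF P X] .
  \<comment> \<open>A probability measure on a countable discrete space is carried by its atoms, as
    \<open>Abs_pmf\<close> demands.\<close>
  have "AE z in ?D. measure ?D {z} \<noteq> 0"
    by (subst D.AE_support_countable) (auto intro!: exI[of _ UNIV])
  then show ?thesis
    unfolding law_def by (intro Abs_pmf_inverse) (auto simp: D.prob_space_axioms)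
qed

lemma measure_law:
  assumes M: "markov_family P X" and t: "0 \<le> t"
  shows "measure (law P X t x) A = \<P>(\<omega> in P x. X t \<omega> \<in> A)"
proof -
  have "X t \<in> P x \<rightarrow>\<^sub>M count_space UNIV" using assms by (auto simp: markov_family_def)
  then show ?thesis
    by (simp add: measure_pmf_law[OF assms] measure_distr vimage_def Int_def conj_commute)
qed

lemma pmf_law:
  assumes "markov_family P X" "0 \<le> t"
  shows "pmf (law P X t x) y = transition_prob P X t x y"
  using measure_law[OF assms, of x "{y}"] by (simp add: measure_pmf_single transition_prob_def)

lemma expectation_law:
  fixes v :: "nat \<Rightarrow> real"
  assumes "markov_family P X" "0 \<le> t"
  shows "measure_pmf.expectation (law P X t x) v = (\<integral>\<omega>. v (X t \<omega>) \<partial>P x)"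
proof -
  have "X t \<in> P x \<rightarrow>\<^sub>M count_space UNIV" using assms by (auto simp: markov_family_def)
  then show ?thesis by (simp add: measure_pmf_law[OF assms] integral_distr)
qed

lemma expectation_nat_pmf_sums:
  fixes v :: "nat \<Rightarrow> real"
  assumes "\<And>x. \<bar>v x\<bar> \<le> C"
  shows "(\<lambda>z. pmf p z * v z) sums measure_pmf.expectation p v"
proof -
  have "integrable (measure_pmf p) v" by (rule integrable_pmf_bounded[OF assms])
  then have "integrable (count_space UNIV) (\<lambda>z. pmf p z * v z)"
    by (simp add: measure_pmf_eq_density integrable_density)
  then show ?thesis
    using sums_integral_count_space_nat by (simp add: measure_pmf_eq_density integral_density)
qed

lemma bd_semigroup_law:
  assumes "birth_death_process a b P X"
  shows "bd_semigroup a b (law P X)"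
proof -
  have M: "markov_family P X" and rates: "has_bd_rates a b (transition_prob P X)"
    using assms by (auto simp: birth_death_process_def)
  have X: "X t \<in> P x \<rightarrow>\<^sub>M count_space UNIV" if "0 \<le> t" for t x
    using M that by (auto simp: markov_family_def)
  have start: "law P X 0 x = return_pmf x" for x
  proof (rule pmf_eqI)
    fix y
    interpret prob_space "P x" using M by (auto simp: markov_family_def)
    have X0: "AE \<omega> in P x. X 0 \<omega> = x" using M by (auto simp: markov_family_def)
    have [measurable]: "X 0 \<in> P x \<rightarrow>\<^sub>M count_space UNIV" by (rule X) simp
    have "pmf (law P X 0 x) y = \<P>(\<omega> in P x. X 0 \<omega> = y)"
      by (simp add: pmf_law[OF M] transition_prob_def)
    also have "\<dots> = \<P>(\<omega> in P x. x = y)"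
      by (rule measure_eq_AE) (use X0 in auto)
    also have "\<dots> = pmf (return_pmf x) y" by (cases "x = y") (use prob_space in auto)
    finally show "pmf (law P X 0 x) y = pmf (return_pmf x) y" .
  qed
  have chapman: "law P X (s + t) x = bind_pmf (law P X s x) (law P X t)"
    if st: "0 \<le> s" "0 \<le> t" for s t x
  proof (rule pmf_eqI)
    fix y
    interpret prob_space "P x" using M by (auto simp: markov_family_def)
    have [measurable]: "X s \<in> P x \<rightarrow>\<^sub>M count_space UNIV" "X (s + t) \<in> P x \<rightarrow>\<^sub>M count_space UNIV"
      using st by (auto intro: X)
    let ?A = "\<lambda>z. {\<omega> \<in> space (P x). X s \<omega> = z \<and> X (s + t) \<omega> = y}"
    \<comment> \<open>The Markov property with the whole space as past event, summed over the state
      \<open>z\<close> at time \<open>s\<close>, is the Chapman-Kolmogorov equation.\<close>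
    have "space (P x) \<in> natural_filtration (space (P x)) X s"
      unfolding natural_filtration_def by (rule sigma_sets_top)
    then have "\<P>(\<omega> in P x. \<omega> \<in> space (P x) \<and> X s \<omega> = z \<and> X (s + t) \<omega> = y)
        = \<P>(\<omega> in P x. \<omega> \<in> space (P x) \<and> X s \<omega> = z) * transition_prob P X t z y" for z
      using M st unfolding markov_family_def by blast
    then have step: "measure (P x) (?A z) = pmf (law P X s x) z * pmf (law P X t z) y" for z
      using st by (simp add: pmf_law[OF M] transition_prob_def)
    have "(\<lambda>z. measure (P x) (?A z)) sums measure (P x) (\<Union>z. ?A z)"
      by (rule finite_measure_UNION) (auto simp: disjoint_family_on_def)
    also have "(\<Union>z. ?A z) = {\<omega> \<in> space (P x). X (s + t) \<omega> = y}" by auto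
    also have "measure (P x) \<dots> = pmf (law P X (s + t) x) y"
      using st by (simp add: pmf_law[OF M] transition_prob_def)
    finally have "(\<lambda>z. pmf (law P X s x) z * pmf (law P X t z) y) sums pmf (law P X (s + t) x) y"
      unfolding step .
    moreover have "(\<lambda>z. pmf (law P X s x) z * pmf (law P X t z) y)
        sums pmf (bind_pmf (law P X s x) (law P X t)) y"
      unfolding pmf_bind by (rule expectation_nat_pmf_sums[of _ 1]) (simp add: pmf_le_1)
    ultimately show "pmf (law P X (s + t) x) y = pmf (bind_pmf (law P X s x) (law P X t)) y"
      by (rule sums_unique2)
  qed
  have "has_bd_rates a b (\<lambda>t x. pmf (law P X t x))"
    unfolding has_bd_rates_def
  proof (intro allI)
    fix x y
    show "((\<lambda>t. pmf (law P X t x) y) has_real_derivative bd_generator a b (indicator {y}) x) (at_right 0)"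
      using rates unfolding has_bd_rates_def
      by (subst has_field_derivative_cong_eventually[where g = "\<lambda>t. transition_prob P X t x y"])
        (auto simp: pmf_law[OF M] eventually_at_right_field intro!: exI[of _ 1])
  qed
  with start chapman show ?thesis by (simp add: bd_semigroup_def)
qed

theorem corollary4p7:
  fixes lam \<nu> :: "nat \<Rightarrow> real"
    and P :: "nat \<Rightarrow> 'w measure"
    and X :: "real \<Rightarrow> 'w \<Rightarrow> nat"
    and \<pi> :: "nat pmf"
    and f :: "nat \<Rightarrow> real"
    and x :: nat
    and t y :: real
  assumes "birth_death_process lam \<nu> P X"
    and "regular_rates lam \<nu>"
    and "non_explosive P X"
    and "stationary_distribution P X \<pi>"
    and "finite_first_moment \<pi>"
    and "antimono lam"
    and "mono \<nu>"
    and "f \<in> Lip"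
    and "finite_sup_norm (carre_du_champ lam \<nu> f)"
    and "t > 0"
    and "y > 0"
  shows "\<P>(\<omega> in P x. f (X t \<omega>) - (\<integral>\<omega>'. f (X t \<omega>') \<partial>P x) \<ge> y)
    \<le> exp (- (y / (2 * Lip_norm f)) *
        ln (1 + y * Lip_norm f / (2 * t * sup_norm (carre_du_champ lam \<nu> f))))"
proof -
  let ?V = "sup_norm (carre_du_champ lam \<nu> f)" and ?L = "Lip_norm f"
  have rates: "\<And>x. 0 < lam x" "\<nu> 0 = 0" and M: "markov_family P X"
    using assms(1) by (auto simp: birth_death_process_def birth_death_rates_def)
  interpret prob_space "P x" using M by (auto simp: markov_family_def)
  have V: "\<bar>carre_du_champ lam \<nu> f z\<bar> \<le> ?V" for z
    using assms(9) unfolding sup_norm_def finite_sup_norm_def by (intro cSUP_upper) auto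
  \<comment> \<open>The difference quotient at the pair \<open>(z + 1, z)\<close> has denominator
    1.\<close>
  have L: "\<bar>f (z + 1) - f z\<bar> \<le> ?L" for z
    using cSUP_upper[of "(z + 1, z)" "{(x, y). x \<noteq> y}"
        "\<lambda>(x, y). \<bar>f x - f y\<bar> / \<bar>real x - real y\<bar>"] assms(8)
    by (simp add: Lip_def Lip_norm_def)
  show ?thesis
  proof (cases "0 < ?L \<and> 0 < ?V")
    case True
    have "measure (law P X t x) {z. y \<le> f z - measure_pmf.expectation (law P X t x) f}
      \<le> exp (- (y / (2 * ?L)) * ln (1 + y * ?L / (2 * t * ?V)))"
      using rates assms True L V by (intro bd_semigroup_deviation[OF bd_semigroup_law[OF assms(1)]])
        (auto simp: less_imp_le intro: order_trans[OF abs_ge_self])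
    then show ?thesis
      using assms(10) by (simp add: measure_law[OF M] expectation_law[OF M])
  next
    text \<open>The right-hand side is 1 by \<open>a / 0 = 0\<close>.\<close>
    case False
    then have "?L = 0 \<or> ?V = 0"
      using order_trans[OF abs_ge_zero L] order_trans[OF abs_ge_zero V] by (meson antisym not_le)
    then have rhs: "exp (- (y / (2 * ?L)) * ln (1 + y * ?L / (2 * t * ?V))) = 1" by auto
    show ?thesis unfolding rhs by (rule prob_le_1)
  qed
qed

end
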